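(* Let $\mathcal{K}$ be a Kreĭn space, regularly irreducible under the action of a group $G$ of unitary operators. Let $A$ be a bounded definitizable (self-adjoint) operator on $\mathcal{K}$ and suppose that $TA=AT$ for all $T\in G$. Then $A=N+\lambda I$ with $N$ nilpotent and $\lambda$ a scalar. If moreover the representation is non-degenerate, then $A=\lambda I$.
   Context: A Kreĭn space is a space $\mathcal{K}$ with a Hermitian sesquilinear form $[\cdot,\cdot]$ admitting a fundamental symmetry $J$ ($J^2=I$, $\langle x,y\rangle=[Jx,y]$ a Hilbert inner product); its topology is that of any such Hilbert norm. Adjoints $A^{[*]}$, self-adjointness ($A^{[*]}=A$), unitarity ($T^{[*]}T=TT^{[*]}=I$) and positivity ($[Ax,x]\ge0$ for all $x$) are with respect to $[\cdot,\cdot]$. A self-adjoint operator $A$ is definitizable if there exists a polynomial $p$ such that $p(A)$ is a positive operator. A subspace is regular if it is closed and a Kreĭn space for the restricted form. $\mathcal{K}$ is regularly irreducible under $G$ if it has no $G$-invariant regular subspace other than $0$ and $\mathcal{K}$. The representation is non-degenerate if $\mathcal{K}$ has no (nonzero) neutral $G$-invariant subspace, where a subspace is neutral if $[x,x]=0$ for all its elements $x$.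
   Formalization: The first conclusion assumes all eigenvalues of A are real; as printed it fails for A=diag(i,-i) on C^2 with [x,y]=x1 conj(y2)+x2 conj(y1), G={diag(t,1/t)}, p=z^2+1. The polynomial in "definitizable" is taken nonzero. The non-degenerate claim is unchanged. *)

theory Defs
  imports
    "HOL-Analysis.Analysis"
    "HOL-Algebra.Group"
    "HOL-Computational_Algebra.Polynomial"
begin

section \<open>Hermitian sesquilinear forms and Krein spaces\<close>

text \<open>The distribution has no type class of complex vector spaces, and the norm of a Krein
  space is only determined up to equivalence, so the scalar multiplication and the indefinite
  form are the operations of a new class. The form is linear in its first argument.\<close>

class hermitian_form_space = ab_group_add +
  fixes scaleC :: "complex \<Rightarrow> 'a \<Rightarrow> 'a"  (infixr \<open>*\<^sub>C\<close> 75)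
    and kform :: "'a \<Rightarrow> 'a \<Rightarrow> complex"
  assumes scaleC_add_right: "c *\<^sub>C (x + y) = c *\<^sub>C x + c *\<^sub>C y"
    and scaleC_add_left: "(c + d) *\<^sub>C x = c *\<^sub>C x + d *\<^sub>C x"
    and scaleC_scaleC: "c *\<^sub>C d *\<^sub>C x = (c * d) *\<^sub>C x"
    and scaleC_one: "1 *\<^sub>C x = x"
    and kform_add_left: "kform (x + y) z = kform x z + kform y z"
    and kform_scale_left: "kform (c *\<^sub>C x) y = c * kform x y"
    and kform_hermitian: "kform y x = cnj (kform x y)"

global_interpretation complex_vector: vector_space scaleC
  by standard (fact scaleC_add_right scaleC_add_left scaleC_scaleC scaleC_one)+

definition (in hermitian_form_space) jnorm :: "('a \<Rightarrow> 'a) \<Rightarrow> 'a \<Rightarrow> real" where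
  "jnorm J x = sqrt (Re (kform (J x) x))"

text \<open>\<open>J\<close> is a fundamental symmetry for the restriction of the form to the subspace \<open>S\<close>;
  only the values of \<open>J\<close> on \<open>S\<close> matter. The last three clauses say that
  \<open>\<langle>x,y\<rangle> = [Jx,y]\<close> is a Hilbert space inner product on \<open>S\<close>.\<close>

definition (in hermitian_form_space) fundamental_symmetry_on ::
  "'a set \<Rightarrow> ('a \<Rightarrow> 'a) \<Rightarrow> bool" where
  "fundamental_symmetry_on S J \<longleftrightarrow>
     (\<forall>x\<in>S. J x \<in> S \<and> J (J x) = x) \<and>
     (\<forall>x\<in>S. \<forall>y\<in>S. J (x + y) = J x + J y) \<and>
     (\<forall>c. \<forall>x\<in>S. J (c *\<^sub>C x) = c *\<^sub>C J x) \<and>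
     (\<forall>x\<in>S. \<forall>y\<in>S. kform (J y) x = cnj (kform (J x) y)) \<and>
     (\<forall>x\<in>S. x \<noteq> 0 \<longrightarrow> kform (J x) x \<in> \<real> \<and> Re (kform (J x) x) > 0) \<and>
     (\<forall>X. range X \<subseteq> S \<and>
          (\<forall>e>0. \<exists>M. \<forall>m\<ge>M. \<forall>n\<ge>M. jnorm J (X m - X n) < e) \<longrightarrow>
          (\<exists>x\<in>S. (\<lambda>n. jnorm J (X n - x)) \<longlonglongrightarrow> 0))"

class krein_space = hermitian_form_space +
  assumes ex_fundamental_symmetry: "\<exists>J. fundamental_symmetry_on UNIV J"

text \<open>All the norms given by fundamental symmetries are equivalent, so the choice made here
  affects neither the topology nor which operators are bounded.\<close>

definition knorm :: "'a::krein_space \<Rightarrow> real" where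
  "knorm = jnorm (SOME J. fundamental_symmetry_on UNIV J)"

definition krein_topology :: "'a::krein_space topology" where
  "krein_topology = Metric_space.mtopology UNIV (\<lambda>x y. knorm (x - y))"

section \<open>Operators\<close>

definition bounded_operator :: "('a::krein_space \<Rightarrow> 'a) \<Rightarrow> bool" where
  "bounded_operator A \<longleftrightarrow>
     Vector_Spaces.linear scaleC scaleC A \<and> (\<exists>C. \<forall>x. knorm (A x) \<le> C * knorm x)"

text \<open>\<open>B\<close> is the adjoint of \<open>A\<close> with respect to the form; it is unique
  because the form of a Krein space is nondegenerate.\<close>

definition is_kadjoint :: "('a::krein_space \<Rightarrow> 'a) \<Rightarrow> ('a \<Rightarrow> 'a) \<Rightarrow> bool" where
  "is_kadjoint A B \<longleftrightarrow> (\<forall>x y. kform (A x) y = kform x (B y))"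

definition kselfadjoint :: "('a::krein_space \<Rightarrow> 'a) \<Rightarrow> bool" where
  "kselfadjoint A \<longleftrightarrow> is_kadjoint A A"

definition kunitary :: "('a::krein_space \<Rightarrow> 'a) \<Rightarrow> bool" where
  "kunitary T \<longleftrightarrow> bounded_operator T \<and>
     (\<exists>S. bounded_operator S \<and> is_kadjoint T S \<and> S \<circ> T = id \<and> T \<circ> S = id)"

definition kpositive :: "('a::krein_space \<Rightarrow> 'a) \<Rightarrow> bool" where
  "kpositive A \<longleftrightarrow> (\<forall>x. kform (A x) x \<in> \<real>\<^sub>\<ge>\<^sub>0)"

definition poly_op :: "complex poly \<Rightarrow> ('a::krein_space \<Rightarrow> 'a) \<Rightarrow> 'a \<Rightarrow> 'a" where
  "poly_op p A x = (\<Sum>i\<le>degree p. coeff p i *\<^sub>C (A ^^ i) x)"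

text \<open>The zero polynomial has to be excluded: it would make every self-adjoint operator
  definitizable. Allowing complex coefficients is no more general than real ones: if
  \<open>p(A)\<close> is positive it is self-adjoint, hence equals \<open>(Re p)(A)\<close>, and if \<open>Re p = 0\<close>
  then \<open>(Im p)(A) = 0\<close> is positive.

  A definitizable operator can have non-real eigenvalues, also when it commutes with a regularly
  irreducible group: take \<open>diag(i,-i)\<close> on the plane with form
  \<open>[x,y] = x1 cnj(y2) + x2 cnj(y1)\<close>, \<open>p = z^2 + 1\<close> and the group of all
  \<open>diag(t,1/t)\<close> with \<open>t\<close> real and nonzero. This operator is not the sum of a nilpotent
  operator and a scalar.\<close>

definition definitizable :: "('a::krein_space \<Rightarrow> 'a) \<Rightarrow> bool" where
  "definitizable A \<longleftrightarrow> kselfadjoint A \<and> (\<exists>p. p \<noteq> 0 \<and> kpositive (poly_op p A))"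

definition nilpotent_operator :: "('a::krein_space \<Rightarrow> 'a) \<Rightarrow> bool" where
  "nilpotent_operator N \<longleftrightarrow> bounded_operator N \<and> (\<exists>n. \<forall>x. (N ^^ n) x = 0)"

section \<open>Groups of unitary operators\<close>

definition unitary_group :: "('a::krein_space \<Rightarrow> 'a) monoid" where
  "unitary_group = \<lparr>carrier = {T. kunitary T}, mult = (\<circ>), one = id\<rparr>"

definition invariant_subspace ::
  "('a::krein_space \<Rightarrow> 'a) set \<Rightarrow> 'a set \<Rightarrow> bool" where
  "invariant_subspace G S \<longleftrightarrow> module.subspace scaleC S \<and> (\<forall>T\<in>G. T ` S \<subseteq> S)"

definition regular_subspace :: "'a::krein_space set \<Rightarrow> bool" where
  "regular_subspace S \<longleftrightarrow> module.subspace scaleC S \<and> closedin krein_topology S \<and>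
     (\<exists>J. fundamental_symmetry_on S J)"

definition neutral_subspace :: "'a::krein_space set \<Rightarrow> bool" where
  "neutral_subspace S \<longleftrightarrow> module.subspace scaleC S \<and> (\<forall>x\<in>S. kform x x = 0)"

definition regularly_irreducible :: "('a::krein_space \<Rightarrow> 'a) set \<Rightarrow> bool" where
  "regularly_irreducible G \<longleftrightarrow>
     (\<forall>S. regular_subspace S \<and> invariant_subspace G S \<longrightarrow> S = {0} \<or> S = UNIV)"

definition nondegenerate_representation :: "('a::krein_space \<Rightarrow> 'a) set \<Rightarrow> bool" where
  "nondegenerate_representation G \<longleftrightarrow>
     (\<forall>S. neutral_subspace S \<and> invariant_subspace G S \<longrightarrow> S = {0})"

end

theory Submission
  imports Defs "HOL-Computational_Algebra.Fundamental_Theorem_Algebra"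
begin

text \<open>Let \<open>p(A)\<close> be positive, with \<open>p\<close> real. The form \<open>[p(A) x, y]\<close> is positive semidefinite and
  \<open>A\<close> is symmetric and bounded for it, so \<open>f(A) p(A)\<close> makes sense for every continuous \<open>f\<close>. If
  \<open>f = 1 / p\<close> where \<open>\<bar>p\<bar>\<close> is not small and \<open>p\<close> has constant sign, the invariant subspace
  \<open>f(A) p(A) x = x\<close> is uniformly definite, hence regular. If one of these subspaces is the whole
  space, the form is definite and the Hilbert space argument shows that \<open>A\<close> is a scalar. If all
  of them vanish, then \<open>f(A) p(A) = 0\<close> for all \<open>f\<close> that vanish near the zeros of \<open>p\<close>, and
  \<open>p(A)^2 = 0\<close> by approximation. In the latter case the Riesz projection of a real eigenvalue is a
  real polynomial in \<open>A\<close>, so its range is regular and must be the whole space.\<close>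

section \<open>Krein spaces as normed spaces\<close>

text \<open>The obstacle is that no spectral theorem applies: the form \<open>[p(A) x, y]\<close>
  may be degenerate, so one cannot expect an operator \<open>f(A)\<close>, only
  \<open>f(A) p(A)\<close>. It is built by hand. Boundedness of \<open>A\<close> gives an interval
  \<open>[a, b]\<close> that contains its numerical range relative to this form. A real polynomial
  nonnegative on \<open>[a, b]\<close> is an explicit combination of squares, \<open>t - a\<close>
  and \<open>b - t\<close>, and therefore gives a nonnegative form; so uniform approximation on
  \<open>[a, b]\<close> becomes norm convergence after a factor \<open>p(A)\<close> is applied. The
  same calculus serves three times: for \<open>p(A)\<close>, for plus or minus the identity when the
  form is definite, and for the Gram operator of a projection, where it supplies the fundamental
  symmetry. Irreducibility speaks of regular subspaces only, so each appeal to it concerns a kernel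
  on which a fundamental symmetry has been exhibited. Positivity of \<open>p(A)\<close> does not
  exclude non-real roots of an annihilating polynomial. This is where real eigenvalues enter: by
  assumption in the first claim, by \<open>eigenvalue_real\<close> in the second.\<close>

abbreviation clinear :: "('a::hermitian_form_space \<Rightarrow> 'a) \<Rightarrow> bool" where
  "clinear \<equiv> Vector_Spaces.linear scaleC scaleC"

lemma clinear_iff:
  "clinear F \<longleftrightarrow> (\<forall>x y. F (x + y) = F x + F y) \<and> (\<forall>c x. F (c *\<^sub>C x) = c *\<^sub>C F x)"
  by (auto simp: Vector_Spaces.linear_iff complex_vector.vector_space_axioms)

lemma clinear_simps:
  assumes "clinear F"
  shows "F (x + y) = F x + F y" "F (c *\<^sub>C x) = c *\<^sub>C F x" "F 0 = 0" "F (- x) = - F x"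
    "F (x - y) = F x - F y"
proof -
  show 1: "F (x + y) = F x + F y" "F (c *\<^sub>C x) = c *\<^sub>C F x" for x y c
    using assms by (auto simp: clinear_iff)
  show 2: "F 0 = 0"
    using 1(2)[of 0 0] by simp
  show 3: "F (- x) = - F x" for x
    using 1(1)[of x "- x"] 2 by (simp add: eq_neg_iff_add_eq_0[THEN iffD2] add.commute[of _ "F x"])
  show "F (x - y) = F x - F y"
    using 1(1)[of x "- y"] 3[of y] by simp
qed

lemma kform_zero_left [simp]: "kform 0 (y::'a::hermitian_form_space) = 0"
  using kform_add_left[of 0 0 y] by simp

lemma kform_zero_right [simp]: "kform (x::'a::hermitian_form_space) 0 = 0"
  using kform_hermitian[of x 0] by simp

lemma kform_add_right: "kform (x::'a::hermitian_form_space) (y + z) = kform x y + kform x z"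
  by (simp only: kform_hermitian[of x] kform_add_left complex_cnj_add)

lemma kform_scale_right: "kform (x::'a::hermitian_form_space) (c *\<^sub>C y) = cnj c * kform x y"
  by (simp only: kform_hermitian[of x] kform_scale_left complex_cnj_mult)

lemma kform_minus_left: "kform (- (x::'a::hermitian_form_space)) y = - kform x y"
  using kform_scale_left[of "- 1" x y] by (simp add: scaleC_one)

lemma kform_minus_right: "kform (x::'a::hermitian_form_space) (- y) = - kform x y"
  using kform_scale_right[of x "- 1" y] by (simp add: scaleC_one)

lemma kform_diff_left: "kform (x - y) (z::'a::hermitian_form_space) = kform x z - kform y z"
  using kform_add_left[of x "- y" z] by (simp add: kform_minus_left)

lemma kform_diff_right: "kform (x::'a::hermitian_form_space) (y - z) = kform x y - kform x z"
  using kform_add_right[of x y "- z"] by (simp add: kform_minus_right)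

lemmas kform_simps = kform_add_left kform_add_right kform_scale_left kform_scale_right
  kform_minus_left kform_minus_right kform_diff_left kform_diff_right

lemma kform_self_real: "Im (kform (x::'a::hermitian_form_space) x) = 0"
  using arg_cong[OF kform_hermitian[of x x], of Im] by simp

lemma kpositive_iff: "kpositive H \<longleftrightarrow> (\<forall>x. Im (kform (H x) x) = 0 \<and> Re (kform (H x) x) \<ge> 0)"
  by (auto simp: kpositive_def complex_nonneg_Reals_iff)

text \<open>Polarization: reality of the quadratic form at \<open>x + y\<close> relates the
  imaginary parts, reality at \<open>x + \<i> *\<^sub>C y\<close> the real parts.\<close>

lemma kpositive_selfadjoint:
  assumes "clinear H" "kpositive H"
  shows "kform (H x) y = kform x (H y)"
proof -
  note lin = clinear_simps[OF assms(1)]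
  have r: "Im (kform (H x) x) = 0" for x
    using assms(2) by (simp add: kpositive_iff)
  have 1: "Im (kform (H x) y) + Im (kform (H y) x) = 0"
    using r[of "x + y"] r[of x] r[of y] by (simp add: lin kform_simps)
  have 2: "Re (kform (H x) y) = Re (kform (H y) x)"
    using r[of "x + \<i> *\<^sub>C y"] r[of x] r[of y] by (simp add: lin kform_simps)
  have "kform (H x) y = cnj (kform (H y) x)"
    using 1 2 by (simp add: complex_eq_iff)
  then show ?thesis by (simp add: kform_hermitian[of "H y" x])
qed

lemma quadratic_discriminant_bound:
  fixes a b c :: real
  assumes "\<And>t. 0 \<le> a + 2 * t * b + t\<^sup>2 * c"
  shows "b\<^sup>2 \<le> a * c"
proof (cases "c = 0")
  case True
  have "b = 0"
  proof (rule ccontr)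
    assume "b \<noteq> 0"
    then show False
      \<comment> \<open>At this \<open>t\<close> the expression, linear when \<open>c = 0\<close>,
        has the value -1.\<close>
      using assms[of "- (a + 1) / (2 * b)"] True by (simp add: field_simps)
  qed
  then show ?thesis using True by simp
next
  case False
  have "c > 0"
  proof (rule ccontr)
    assume "\<not> c > 0"
    with False have c: "c < 0" by simp
    have "a \<ge> 0" using assms[of 0] by simp
    \<comment> \<open>Averaging the values at \<open>t\<close> and \<open>- t\<close> removes the
      linear term.\<close>
    have "0 \<le> a + t\<^sup>2 * c" for t
      using assms[of t] assms[of "- t"] by simp
    from this[of "sqrt ((a + 1) / - c)"] c \<open>a \<ge> 0\<close> show False
      by (simp add: field_simps)
  qed
  then show ?thesis
    using assms[of "- b / c"] by (simp add: field_simps power2_eq_square)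
qed

text \<open>The phase \<open>u\<close> turns \<open>[H x, y]\<close> into its modulus, so that
  \<open>x + t u' y\<close>, with \<open>u'\<close> the conjugate of \<open>u\<close>, gives a real
  quadratic polynomial in \<open>t\<close> to which the discriminant bound applies. \<open>H\<close>
  may have a kernel, so the leading coefficient may vanish.\<close>

lemma kpositive_cauchy_schwarz:
  assumes "clinear H" "kpositive H"
  shows "(cmod (kform (H x) y))\<^sup>2 \<le> Re (kform (H x) x) * Re (kform (H y) y)"
proof -
  note lin = clinear_simps[OF assms(1)]
  define k where "k = kform (H x) y"
  obtain u where u: "cmod u = 1" "u * k = of_real (cmod k)"
  proof (cases "k = 0")
    case True
    then show ?thesis by (intro that[of 1]) auto
  next
    case False
    then have "cnj k * k = of_real (cmod k) * of_real (cmod k)"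
      by (metis complex_norm_square mult.commute power2_eq_square of_real_mult)
    then show ?thesis using False
      by (intro that[of "cnj k / of_real (cmod k)"]) (auto simp: norm_divide field_simps)
  qed
  have uu: "u * cnj u = 1"
    by (metis complex_norm_square of_real_1 one_power2 u(1))
  have xy: "kform (H y) x = cnj k"
    using kpositive_selfadjoint[OF assms, of y x] kform_hermitian[of "H x" y] by (simp add: k_def)
  have "0 \<le> Re (kform (H x) x) + 2 * t * cmod k + t\<^sup>2 * Re (kform (H y) y)" for t
  proof -
    define z where "z = x + (of_real t * cnj u) *\<^sub>C y"
    have "kform (H z) z = kform (H x) x + of_real t * (u * k) + of_real t * cnj (u * k)
        + (u * cnj u) * of_real t * of_real t * kform (H y) y"
      unfolding z_def by (simp add: lin kform_simps xy k_def[symmetric] algebra_simps)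
    also have "Re \<dots> = Re (kform (H x) x) + 2 * t * cmod k + t\<^sup>2 * Re (kform (H y) y)"
      by (simp add: uu u(2) power2_eq_square)
    finally show ?thesis
      using assms(2) by (metis kpositive_iff)
  qed
  then show ?thesis
    using quadratic_discriminant_bound unfolding k_def by blast
qed

section \<open>The chosen fundamental symmetry and its norm\<close>

definition fsym :: "'a::krein_space \<Rightarrow> 'a" where
  "fsym = (SOME J. fundamental_symmetry_on UNIV J)"

lemma fsym: "fundamental_symmetry_on UNIV (fsym :: 'a::krein_space \<Rightarrow> 'a)"
  unfolding fsym_def using someI_ex[OF ex_fundamental_symmetry] .

lemma fsym_fsym [simp]: "fsym (fsym x) = (x::'a::krein_space)"
proof -
  have "\<forall>x\<in>UNIV. fsym x \<in> UNIV \<and> fsym (fsym x) = (x::'a)"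
    using fsym unfolding fundamental_symmetry_on_def by (elim conjE)
  then show ?thesis by simp
qed

lemma clinear_fsym: "clinear (fsym :: 'a::krein_space \<Rightarrow> 'a)"
proof -
  have "\<forall>x\<in>UNIV. \<forall>y\<in>UNIV. fsym (x + y) = fsym x + fsym (y::'a)"
    using fsym unfolding fundamental_symmetry_on_def by (elim conjE)
  moreover have "\<forall>c. \<forall>x\<in>UNIV. fsym (c *\<^sub>C x) = c *\<^sub>C fsym (x::'a)"
    using fsym unfolding fundamental_symmetry_on_def by (elim conjE)
  ultimately show ?thesis by (simp add: clinear_iff)
qed

lemma fsym_0 [simp]: "fsym (0::'a::krein_space) = 0"
  by (rule clinear_simps(3)[OF clinear_fsym])

lemma fsym_pos:
  assumes "x \<noteq> (0::'a::krein_space)"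
  shows "Im (kform (fsym x) x) = 0" "Re (kform (fsym x) x) > 0"
proof -
  have "\<forall>x\<in>UNIV. x \<noteq> 0 \<longrightarrow> kform (fsym x) x \<in> \<real> \<and> Re (kform (fsym x) (x::'a)) > 0"
    using fsym unfolding fundamental_symmetry_on_def by (elim conjE)
  then show "Im (kform (fsym x) x) = 0" "Re (kform (fsym x) x) > 0"
    using assms by (auto simp: complex_is_Real_iff)
qed

lemma kpositive_fsym: "kpositive (fsym :: 'a::krein_space \<Rightarrow> 'a)"
  unfolding kpositive_iff
proof
  fix x :: 'a
  show "Im (kform (fsym x) x) = 0 \<and> Re (kform (fsym x) x) \<ge> 0"
    using fsym_pos[of x] by (cases "x = 0") (auto simp: less_imp_le)
qed

lemma fsym_adjoint: "kform (fsym x) y = kform x (fsym (y::'a::krein_space))"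
  by (rule kpositive_selfadjoint[OF clinear_fsym kpositive_fsym])

lemma knorm_eq_jnorm: "knorm = (jnorm fsym :: 'a::krein_space \<Rightarrow> real)"
  by (simp add: knorm_def fsym_def)

lemma knorm_eq_sqrt: "knorm x = sqrt (Re (kform (fsym x) (x::'a::krein_space)))"
  by (simp add: knorm_eq_jnorm jnorm_def)

lemma knorm_sq: "(knorm x)\<^sup>2 = Re (kform (fsym x) (x::'a::krein_space))"
  using kpositive_fsym by (auto simp: knorm_eq_sqrt kpositive_iff)

lemma knorm_nonneg [simp]: "knorm (x::'a::krein_space) \<ge> 0"
  using kpositive_fsym by (auto simp: knorm_eq_sqrt kpositive_iff)

lemma knorm_eq_0_iff [simp]: "knorm x = 0 \<longleftrightarrow> (x::'a::krein_space) = 0"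
  using fsym_pos(2)[of x] by (cases "x = 0") (simp_all add: knorm_eq_sqrt)

lemma knorm_0 [simp]: "knorm (0::'a::krein_space) = 0" by simp

lemma knorm_fsym [simp]: "knorm (fsym x) = knorm (x::'a::krein_space)"
  by (simp add: knorm_eq_sqrt fsym_adjoint)

lemma kform_fsym_bound: "cmod (kform (fsym x) y) \<le> knorm x * knorm (y::'a::krein_space)"
proof (rule power2_le_imp_le)
  show "(cmod (kform (fsym x) y))\<^sup>2 \<le> (knorm x * knorm y)\<^sup>2"
    unfolding power_mult_distrib knorm_sq
    by (rule kpositive_cauchy_schwarz[OF clinear_fsym kpositive_fsym])
qed simp

lemma kform_bound: "cmod (kform x y) \<le> knorm x * knorm (y::'a::krein_space)"
  using kform_fsym_bound[of "fsym x" y] by simp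

lemma knorm_scale: "knorm (c *\<^sub>C x) = cmod c * knorm (x::'a::krein_space)"
proof (rule power2_eq_imp_eq)
  have "kform (fsym (c *\<^sub>C x)) (c *\<^sub>C x) = (c * cnj c) * kform (fsym x) x"
    by (simp add: clinear_simps[OF clinear_fsym] kform_simps)
  also have "\<dots> = of_real ((cmod c)\<^sup>2) * kform (fsym x) x"
    by (metis complex_norm_square)
  finally show "(knorm (c *\<^sub>C x))\<^sup>2 = (cmod c * knorm x)\<^sup>2"
    by (simp add: knorm_sq power_mult_distrib)
qed auto

lemma knorm_minus: "knorm (- x) = knorm (x::'a::krein_space)"
  using knorm_scale[of "- 1" x] by (simp add: scaleC_one)

lemma knorm_diff_commute: "knorm (x - y) = knorm (y - (x::'a::krein_space))"
  using knorm_minus[of "x - y"] by simp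

lemma knorm_triangle: "knorm (x + y) \<le> knorm x + knorm (y::'a::krein_space)"
proof (rule power2_le_imp_le)
  have "(knorm (x + y))\<^sup>2 = (knorm x)\<^sup>2 + (knorm y)\<^sup>2 + Re (kform (fsym x) y) + Re (kform (fsym y) x)"
    by (simp add: knorm_sq clinear_simps[OF clinear_fsym] kform_simps)
  moreover have "Re (kform (fsym x) y) \<le> knorm x * knorm y"
    using kform_fsym_bound[of x y] complex_Re_le_cmod order_trans by blast
  moreover have "Re (kform (fsym y) x) \<le> knorm x * knorm y"
    using kform_fsym_bound[of y x] complex_Re_le_cmod order_trans by (metis mult.commute)
  ultimately show "(knorm (x + y))\<^sup>2 \<le> (knorm x + knorm y)\<^sup>2"
    by (simp add: power2_sum)
qed auto

lemma knorm_triangle_diff: "knorm (x - z) \<le> knorm (x - y) + knorm (y - (z::'a::krein_space))"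
  using knorm_triangle[of "x - y" "y - z"] by simp

lemma kform_nondegenerate:
  assumes "\<And>y. kform x y = 0"
  shows "(x::'a::krein_space) = 0"
proof -
  have "(knorm x)\<^sup>2 = 0"
    using assms[of "fsym x"] by (simp add: knorm_sq fsym_adjoint)
  then show ?thesis by simp
qed

section \<open>Convergence in norm\<close>

definition kconv :: "(nat \<Rightarrow> 'a::krein_space) \<Rightarrow> 'a \<Rightarrow> bool" where
  "kconv X l \<longleftrightarrow> (\<lambda>n. knorm (X n - l)) \<longlonglongrightarrow> 0"

lemma kconv_le:
  assumes "\<And>n. knorm (X n - l) \<le> e n" "e \<longlonglongrightarrow> 0"
  shows "kconv X l"
  unfolding kconv_def
  by (rule tendsto_sandwich[OF _ _ tendsto_const assms(2)]) (auto simp: assms(1))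

lemma kconv_const [simp]: "kconv (\<lambda>n. l) l"
  by (simp add: kconv_def)

lemma kconv_cong_diff:
  assumes "kconv X l" "kconv (\<lambda>n. X n - Y n) 0"
  shows "kconv Y l"
proof (rule kconv_le)
  show "knorm (Y n - l) \<le> knorm (X n - Y n - 0) + knorm (X n - l)" for n
    using knorm_triangle_diff[of "Y n" l "X n"] knorm_diff_commute[of "X n" "Y n"] by simp
  show "(\<lambda>n. knorm (X n - Y n - 0) + knorm (X n - l)) \<longlonglongrightarrow> 0"
    using tendsto_add[OF assms(2)[unfolded kconv_def] assms(1)[unfolded kconv_def]] by simp
qed

lemma kconv_add:
  assumes "kconv X l" "kconv Y m"
  shows "kconv (\<lambda>n. X n + Y n) (l + m)"
proof (rule kconv_le)
  show "knorm (X n + Y n - (l + m)) \<le> knorm (X n - l) + knorm (Y n - m)" for n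
    using knorm_triangle[of "X n - l" "Y n - m"] by (simp add: algebra_simps)
  show "(\<lambda>n. knorm (X n - l) + knorm (Y n - m)) \<longlonglongrightarrow> 0"
    using tendsto_add[OF assms[unfolded kconv_def]] by simp
qed

lemma kconv_unique:
  assumes "kconv X l" "kconv X m"
  shows "l = m"
proof -
  have "(\<lambda>n. knorm (X n - l) + knorm (X n - m)) \<longlonglongrightarrow> 0 + 0"
    using assms unfolding kconv_def by (intro tendsto_add)
  moreover have "knorm (l - m) \<le> knorm (X n - l) + knorm (X n - m)" for n
    using knorm_triangle_diff[of l m "X n"] by (simp add: knorm_diff_commute)
  ultimately have "knorm (l - m) \<le> 0"
    by (intro LIMSEQ_le_const) auto
  then have "knorm (l - m) = 0"
    by (intro order_antisym) auto
  then show ?thesis by simp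
qed

lemma bounded_operator_clinear: "bounded_operator Q \<Longrightarrow> clinear Q"
  by (simp add: bounded_operator_def)

lemma bounded_operator_bound:
  assumes "bounded_operator Q"
  shows "\<exists>C\<ge>0. \<forall>x. knorm (Q x) \<le> C * knorm x"
proof -
  from assms obtain C where C: "\<forall>x. knorm (Q x) \<le> C * knorm x"
    unfolding bounded_operator_def by (elim conjE exE)
  have "knorm (Q x) \<le> max C 0 * knorm x" for x
    by (rule order_trans[OF C[rule_format] mult_right_mono]) simp_all
  then show ?thesis by (intro exI[of _ "max C 0"]) simp
qed

lemma kconv_bounded_operator:
  assumes "bounded_operator Q" "kconv X l"
  shows "kconv (\<lambda>n. Q (X n)) (Q l)"
proof -
  obtain C where C: "C \<ge> 0" "\<And>x. knorm (Q x) \<le> C * knorm x"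
    using bounded_operator_bound[OF assms(1)] by blast
  note lin = bounded_operator_clinear[OF assms(1)]
  show ?thesis
  proof (rule kconv_le)
    show "knorm (Q (X n) - Q l) \<le> C * knorm (X n - l)" for n
      using C(2)[of "X n - l"] by (simp add: clinear_simps[OF lin])
    show "(\<lambda>n. C * knorm (X n - l)) \<longlonglongrightarrow> 0"
      using tendsto_mult[OF tendsto_const assms(2)[unfolded kconv_def]] by simp
  qed
qed

lemma kconv_kform:
  assumes "kconv X l"
  shows "(\<lambda>n. kform (X n) y) \<longlonglongrightarrow> kform l y"
proof (rule LIM_zero_cancel, rule tendsto_norm_zero_cancel,
    rule tendsto_sandwich[OF _ _ tendsto_const])
  show "(\<lambda>n. knorm (X n - l) * knorm y) \<longlonglongrightarrow> 0"
    using tendsto_mult[OF assms[unfolded kconv_def] tendsto_const] by simp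
  show "\<forall>\<^sub>F n in sequentially. cmod (kform (X n) y - kform l y) \<le> knorm (X n - l) * knorm y"
    using kform_bound[of _ y] by (auto simp flip: kform_diff_left)
qed auto

lemma kconv_knorm:
  assumes "kconv X l"
  shows "(\<lambda>n. knorm (X n)) \<longlonglongrightarrow> knorm l"
proof (rule LIM_zero_cancel, rule tendsto_norm_zero_cancel,
    rule tendsto_sandwich[OF _ _ tendsto_const])
  show "(\<lambda>n. knorm (X n - l)) \<longlonglongrightarrow> 0"
    using assms[unfolded kconv_def] .
  show "\<forall>\<^sub>F n in sequentially. norm (knorm (X n) - knorm l) \<le> knorm (X n - l)"
  proof (intro always_eventually allI)
    fix n
    show "norm (knorm (X n) - knorm l) \<le> knorm (X n - l)"
      using knorm_triangle[of "X n - l" l] knorm_triangle[of "l - X n" "X n"]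
        knorm_diff_commute[of "X n" l] by simp
  qed
qed auto

lemma kconv_complete:
  assumes "\<And>e. e > 0 \<Longrightarrow> \<exists>M. \<forall>m\<ge>M. \<forall>n\<ge>M. knorm (X m - X n) < e"
  shows "\<exists>l::'a::krein_space. kconv X l"
proof -
  have "\<forall>X. range X \<subseteq> UNIV \<and>
          (\<forall>e>0. \<exists>M. \<forall>m\<ge>M. \<forall>n\<ge>M. knorm (X m - X n) < e) \<longrightarrow>
          (\<exists>x\<in>UNIV. (\<lambda>n. knorm (X n - x :: 'a)) \<longlonglongrightarrow> 0)"
    using fsym unfolding fundamental_symmetry_on_def knorm_eq_jnorm by (elim conjE)
  then show ?thesis
    using assms by (simp add: kconv_def)
qed

section \<open>Bounded operators and their polynomials\<close>

lemma bounded_operatorI: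
  assumes "\<And>x y. Q (x + y) = Q x + Q y" "\<And>c x. Q (c *\<^sub>C x) = c *\<^sub>C Q x"
    "\<And>x. knorm (Q x) \<le> C * knorm x"
  shows "bounded_operator Q"
  using assms by (auto simp: bounded_operator_def clinear_iff)

lemma bounded_operator_ident: "bounded_operator (\<lambda>x. x)"
  by (rule bounded_operatorI[of _ 1]) auto

lemma bounded_operator_zero: "bounded_operator (\<lambda>x. 0)"
  by (rule bounded_operatorI[of _ 0]) auto

lemma bounded_operator_fsym: "bounded_operator fsym"
  by (rule bounded_operatorI[of _ 1]) (auto simp: clinear_simps[OF clinear_fsym])

lemma bounded_operator_add:
  assumes "bounded_operator P" "bounded_operator Q"
  shows "bounded_operator (\<lambda>x. P x + Q x)"
proof -
  obtain C where C: "C \<ge> 0" "\<And>x. knorm (P x) \<le> C * knorm x"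
    using bounded_operator_bound[OF assms(1)] by blast
  obtain D where D: "D \<ge> 0" "\<And>x. knorm (Q x) \<le> D * knorm x"
    using bounded_operator_bound[OF assms(2)] by blast
  have "knorm (P x + Q x) \<le> (C + D) * knorm x" for x
    using knorm_triangle[of "P x" "Q x"] C(2)[of x] D(2)[of x] by (simp add: distrib_right)
  then show ?thesis
    by (intro bounded_operatorI[of _ "C + D"])
      (simp_all add: scaleC_add_right add_ac clinear_simps[OF bounded_operator_clinear[OF assms(1)]]
        clinear_simps[OF bounded_operator_clinear[OF assms(2)]])
qed

lemma bounded_operator_compose:
  assumes "bounded_operator P" "bounded_operator Q"
  shows "bounded_operator (\<lambda>x. P (Q x))"
proof -
  obtain C where C: "C \<ge> 0" "\<And>x. knorm (P x) \<le> C * knorm x"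
    using bounded_operator_bound[OF assms(1)] by blast
  obtain D where D: "D \<ge> 0" "\<And>x. knorm (Q x) \<le> D * knorm x"
    using bounded_operator_bound[OF assms(2)] by blast
  have "knorm (P (Q x)) \<le> C * D * knorm x" for x
    using order_trans[OF C(2)[of "Q x"] mult_left_mono[OF D(2)[of x] C(1)]] by (simp add: mult.assoc)
  then show ?thesis
    by (intro bounded_operatorI[of _ "C * D"])
      (simp_all add: clinear_simps[OF bounded_operator_clinear[OF assms(1)]]
        clinear_simps[OF bounded_operator_clinear[OF assms(2)]])
qed

lemma bounded_operator_scale:
  assumes "bounded_operator P"
  shows "bounded_operator (\<lambda>x. c *\<^sub>C P x)"
proof -
  have "bounded_operator (\<lambda>x::'a. c *\<^sub>C x)"
    by (rule bounded_operatorI[of _ "cmod c"])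
      (auto simp: scaleC_add_right knorm_scale scaleC_scaleC mult.commute)
  then show ?thesis using bounded_operator_compose[OF _ assms] by blast
qed

lemma bounded_operator_diff:
  assumes "bounded_operator P" "bounded_operator Q"
  shows "bounded_operator (\<lambda>x. P x - Q x)"
  using bounded_operator_add[OF assms(1) bounded_operator_scale[OF assms(2), of "- 1"]]
  by (simp add: scaleC_one)

lemma poly_op_0 [simp]: "poly_op 0 A x = 0"
  by (simp add: poly_op_def)

lemma poly_op_eq_sum:
  assumes "degree p \<le> n"
  shows "poly_op p A x = (\<Sum>i\<le>n. coeff p i *\<^sub>C (A ^^ i) x)"
  unfolding poly_op_def
  by (rule sum.mono_neutral_left) (use assms in \<open>auto simp: coeff_eq_0\<close>)

text \<open>Horner's rule; with it most polynomial identities for operators become inductions along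
  \<open>pCons\<close>.\<close>

lemma poly_op_pCons:
  assumes "clinear A"
  shows "poly_op (pCons c p) A x = c *\<^sub>C x + A (poly_op p A x)"
proof -
  have A_sum: "A (sum f I) = (\<Sum>i\<in>I. A (f i))" for f :: "nat \<Rightarrow> 'a" and I
    by (induction I rule: infinite_finite_induct) (simp_all add: clinear_simps[OF assms])
  have "poly_op (pCons c p) A x = (\<Sum>i\<le>Suc (degree p). coeff (pCons c p) i *\<^sub>C (A ^^ i) x)"
    by (rule poly_op_eq_sum) (rule degree_pCons_le)
  also have "\<dots> = c *\<^sub>C x + (\<Sum>i\<le>degree p. coeff p i *\<^sub>C A ((A ^^ i) x))"
    by (simp add: sum.atMost_Suc_shift del: sum.atMost_Suc)
  finally show ?thesis by (simp add: poly_op_def A_sum clinear_simps[OF assms])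
qed

lemma poly_op_add: "clinear A \<Longrightarrow> poly_op (p + q) A x = poly_op p A x + poly_op q A x"
  by (simp add: poly_op_eq_sum[of _ "max (degree p) (degree q)"] degree_add_le_max
      scaleC_add_left sum.distrib)

lemma poly_op_smult:
  assumes "clinear A"
  shows "poly_op (smult c p) A x = c *\<^sub>C poly_op p A x"
  by (induction p)
    (simp_all add: poly_op_pCons assms scaleC_add_right scaleC_scaleC clinear_simps[OF assms])

lemma poly_op_const: "clinear A \<Longrightarrow> poly_op [:c:] A x = c *\<^sub>C x"
  by (simp add: poly_op_pCons clinear_simps(3)[of A])

lemma poly_op_one: "clinear A \<Longrightarrow> poly_op 1 A x = x"
  by (simp add: one_pCons poly_op_const scaleC_one)

lemma poly_op_diff: "clinear A \<Longrightarrow> poly_op (p - q) A x = poly_op p A x - poly_op q A x"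
  using poly_op_add[of A p "- q" x] poly_op_smult[of A "- 1" q x] by (simp add: scaleC_one)

lemma poly_op_linear_factor: "clinear A \<Longrightarrow> poly_op [:- m, 1:] A x = A x - m *\<^sub>C x"
  by (simp add: poly_op_pCons scaleC_one clinear_simps(3)[of A])

lemma bounded_operator_poly_op:
  assumes "bounded_operator A"
  shows "bounded_operator (poly_op p A)"
proof (induction p)
  case 0
  have "poly_op 0 A = (\<lambda>x. 0)"
    by (rule ext) simp
  then show ?case using bounded_operator_zero by simp
next
  case (pCons c p)
  have "poly_op (pCons c p) A = (\<lambda>x. c *\<^sub>C x + A (poly_op p A x))"
    by (rule ext) (rule poly_op_pCons[OF bounded_operator_clinear[OF assms]])
  moreover have "bounded_operator (\<lambda>x. c *\<^sub>C x + A (poly_op p A x))"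
    by (rule bounded_operator_add[OF bounded_operator_scale[OF bounded_operator_ident]
        bounded_operator_compose[OF assms pCons(2)]])
  ultimately show ?case by (simp only:)
qed

lemma poly_op_commute:
  assumes "clinear A" "clinear Q" "\<And>x. Q (A x) = A (Q x)"
  shows "Q (poly_op p A x) = poly_op p A (Q x)"
  by (induction p) (simp_all add: assms poly_op_pCons clinear_simps[OF assms(2)])

lemma clinear_poly_op:
  assumes "clinear A"
  shows "clinear (poly_op p A)"
proof (induction p)
  case (pCons c p)
  show ?case
    unfolding clinear_iff poly_op_pCons[OF assms]
    by (simp add: clinear_simps[OF assms] clinear_simps[OF pCons(2)] scaleC_add_right
        scaleC_scaleC mult.commute add_ac)
qed (simp add: clinear_iff)

lemma poly_op_mult: "clinear A \<Longrightarrow> poly_op (p * q) A x = poly_op p A (poly_op q A x)"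
  by (induction p) (simp_all add: poly_op_pCons poly_op_add poly_op_smult)

lemma poly_op_adjoint:
  assumes "clinear A" "kselfadjoint A"
  shows "kform (poly_op p A x) y = kform x (poly_op (map_poly cnj p) A y)"
proof (induction p arbitrary: y)
  case (pCons c p)
  have "A (poly_op (map_poly cnj p) A y) = poly_op (map_poly cnj p) A (A y)"
    by (rule poly_op_commute) (use assms in auto)
  moreover have "kform (A u) v = kform u (A v)" for u v
    using assms(2) by (simp add: kselfadjoint_def is_kadjoint_def)
  ultimately show ?case
    by (simp add: poly_op_pCons[OF assms(1)] kform_simps map_poly_pCons pCons(2))
qed simp

section \<open>Real polynomials\<close>

lemma map_poly_of_real_hom:
  fixes p q :: "real poly"
  shows "map_poly complex_of_real (p + q) = map_poly of_real p + map_poly of_real q"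
    "map_poly complex_of_real (p - q) = map_poly of_real p - map_poly of_real q"
    "map_poly complex_of_real (p * q) = map_poly of_real p * map_poly of_real q"
    "map_poly complex_of_real (smult c p) = smult (of_real c) (map_poly of_real p)"
  by (rule poly_eqI, simp add: coeff_map_poly coeff_mult)+

lemma poly_map_poly_of_real: "poly (map_poly of_real p) (of_real t) = complex_of_real (poly p t)"
  by (induction p) (simp_all add: map_poly_pCons)

text \<open>Real coefficients matter because they make the polynomial of a self-adjoint operator
  self-adjoint again (\<open>rop_adjoint\<close>).\<close>

abbreviation rop :: "real poly \<Rightarrow> ('a::krein_space \<Rightarrow> 'a) \<Rightarrow> 'a \<Rightarrow> 'a" where
  "rop f A \<equiv> poly_op (map_poly complex_of_real f) A"

context
  fixes A :: "'a::krein_space \<Rightarrow> 'a"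
  assumes A: "clinear A"
begin

lemma rop_add: "rop (f + g) A x = rop f A x + rop g A x"
  by (simp add: map_poly_of_real_hom poly_op_add A)

lemma rop_diff: "rop (f - g) A x = rop f A x - rop g A x"
  by (simp add: map_poly_of_real_hom poly_op_diff A)

lemma rop_mult: "rop (f * g) A x = rop f A (rop g A x)"
  by (simp add: map_poly_of_real_hom poly_op_mult A)

lemma rop_smult: "rop (smult c f) A x = of_real c *\<^sub>C rop f A x"
  by (simp add: map_poly_of_real_hom poly_op_smult A)

lemma rop_const: "rop [:c:] A x = of_real c *\<^sub>C x"
  by (simp add: map_poly_pCons poly_op_const A)

lemma rop_one: "rop 1 A x = x"
  by (simp add: poly_op_one A)

lemma rop_linear: "rop [:c, d:] A x = of_real c *\<^sub>C x + of_real d *\<^sub>C A x"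
  by (simp add: map_poly_pCons poly_op_pCons A clinear_simps[OF A])

lemma rop_commute:
  assumes "clinear Q" "\<And>x. Q (A x) = A (Q x)"
  shows "Q (rop f A x) = rop f A (Q x)"
  by (rule poly_op_commute[OF A assms])

lemma rop_adjoint:
  assumes "kselfadjoint A"
  shows "kform (rop f A x) y = kform x (rop f A y)"
proof -
  have "map_poly cnj (map_poly complex_of_real f) = map_poly of_real f"
    by (rule poly_eqI) (simp add: coeff_map_poly)
  then show ?thesis
    using poly_op_adjoint[OF A assms, of "map_poly of_real f" x y] by simp
qed

end

section \<open>Polynomials nonnegative on an interval\<close>

inductive interval_cone :: "real \<Rightarrow> real \<Rightarrow> real poly \<Rightarrow> bool" for a b where
  gen: "interval_cone a b ([:- a, 1:] ^ i * [:b, - 1:] ^ j * s\<^sup>2)"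
| add: "interval_cone a b p \<Longrightarrow> interval_cone a b q \<Longrightarrow> interval_cone a b (p + q)"

text \<open>Exponents add and square factors multiply, so generators are closed under products. The
  cone is thus the preordering generated by \<open>t - a\<close> and \<open>b - t\<close>.\<close>

lemma interval_cone_mult:
  assumes "interval_cone a b p" "interval_cone a b q"
  shows "interval_cone a b (p * q)"
  using assms
proof (induction p rule: interval_cone.induct)
  case (gen i j s)
  from gen show ?case
  proof (induction q rule: interval_cone.induct)
    case (gen k l r)
    have "[:- a, 1:] ^ i * [:b, - 1:] ^ j * s\<^sup>2 * ([:- a, 1:] ^ k * [:b, - 1:] ^ l * r\<^sup>2)
        = [:- a, 1:] ^ (i + k) * [:b, - 1:] ^ (j + l) * (s * r)\<^sup>2"
      unfolding power_add power_mult_distrib by (simp only: mult_ac)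
    then show ?case
      using interval_cone.gen[of a b "i + k" "j + l" "s * r"] by (simp only:)
  next
    case (add p q)
    then show ?case by (simp only: distrib_left interval_cone.add)
  qed
next
  case (add p q)
  then show ?case by (simp only: distrib_right interval_cone.add)
qed

lemma interval_cone_square: "interval_cone a b (s\<^sup>2)"
  using interval_cone.gen[of a b 0 0 s] by simp

lemma interval_cone_const: "c \<ge> 0 \<Longrightarrow> interval_cone a b [:c:]"
  using interval_cone_square[of a b "[:sqrt c:]"] by (simp add: power2_eq_square)

lemma interval_cone_left: "interval_cone a b [:- a, 1:]"
  using interval_cone.gen[of a b 1 0 1] by simp

lemma interval_cone_right: "interval_cone a b [:b, - 1:]"
  using interval_cone.gen[of a b 0 1 1] by simp

text \<open>Used after a root \<open>c\<close> has been divided out: the sign of the quotient is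
  then known only away from \<open>c\<close>, and continuity supplies the missing point.\<close>

lemma poly_nonneg_except_point:
  fixes g :: "real poly"
  assumes "a < b" "\<And>t. t \<in> {a..b} \<Longrightarrow> t \<noteq> c \<Longrightarrow> poly g t \<ge> 0" "t \<in> {a..b}"
  shows "poly g t \<ge> 0"
proof (rule ccontr)
  assume "\<not> poly g t \<ge> 0"
  then have neg: "poly g t < 0" by simp
  have "isCont (poly g) t" by simp
  then have "\<forall>\<^sub>F s in at t. poly g s < 0"
    using neg unfolding isCont_def by (rule order_tendstoD(2))
  then obtain d where d: "d > 0" "\<And>s. s \<noteq> t \<Longrightarrow> dist s t < d \<Longrightarrow> poly g s < 0"
    unfolding eventually_at by auto
  \<comment> \<open>Since \<open>4 * e\<close> is at most the length of the interval,
    \<open>t + e\<close> or \<open>t - e\<close> lies inside it.\<close>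
  define e where "e = min (d / 2) ((b - a) / 4)"
  have e: "e > 0" "e < d" "4 * e \<le> b - a"
    using d(1) \<open>a < b\<close> by (auto simp: e_def min_def)
  have t: "t = c"
    using assms(2)[of t] assms(3) neg by force
  show False
  proof (cases "t + e \<le> b")
    case True
    then show False
      using assms(2)[of "t + e"] d(2)[of "t + e"] assms(3) e t by (auto simp: dist_real_def)
  next
    case False
    then show False
      using assms(2)[of "t - e"] d(2)[of "t - e"] assms(3) e t by (auto simp: dist_real_def)
  qed
qed

text \<open>The remainder modulo the quadratic has degree at most 1 and real coefficients; vanishing
  at a non-real point, it is zero.\<close>

lemma real_poly_quadratic_factor:
  fixes f :: "real poly"
  assumes "poly (map_poly of_real f) z = 0" "Im z \<noteq> 0"
  shows "[:(Re z)\<^sup>2 + (Im z)\<^sup>2, - 2 * Re z, 1:] dvd f"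
proof -
  define q where "q = [:(Re z)\<^sup>2 + (Im z)\<^sup>2, - 2 * Re z, 1:]"
  define r where "r = f mod q"
  have q0: "poly (map_poly of_real q) z = 0"
    by (simp add: q_def map_poly_pCons complex_eq_iff power2_eq_square algebra_simps)
  have f: "q * (f div q) + r = f"
    by (simp add: r_def)
  have "poly (map_poly of_real (q * (f div q) + r)) z = poly (map_poly of_real q) z * poly (map_poly of_real (f div q)) z
      + poly (map_poly of_real r) z"
    by (simp only: map_poly_of_real_hom poly_add poly_mult)
  then have r0: "poly (map_poly of_real r) z = 0"
    using assms(1) q0 by (simp add: f)
  have "r = 0 \<or> degree r < degree q"
    unfolding r_def by (rule degree_mod_less) (simp add: q_def)
  then have "degree r \<le> 1"
    by (auto simp: q_def)
  then obtain c d where r: "r = [:c, d:]"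
    by (cases r; cases "degree r = 0") (auto elim!: degree_eq_zeroE split: if_splits)
  have "d = 0 \<and> c = 0"
    using r0 assms(2) unfolding r by (auto simp: map_poly_pCons complex_eq_iff)
  then have "r = 0" by (simp add: r)
  then show ?thesis
    unfolding r_def q_def by (simp add: dvd_eq_mod_eq_0)
qed

lemma nonneg_of_pos_mult: "0 \<le> u * v \<Longrightarrow> 0 < u \<Longrightarrow> 0 \<le> (v::real)"
  by (simp add: zero_le_mult_iff)

text \<open>A one-variable Positivstellensatz, by induction on the degree. A complex root splits off
  a factor in the cone whose cofactor is again nonnegative on the interval: a sum of two squares for
  a non-real root, an endpoint factor plus a constant for a real root not interior to the interval,
  a square for an interior one.\<close>

lemma interval_cone_of_nonneg:
  assumes "a < b" "\<And>t. t \<in> {a..b} \<Longrightarrow> poly f t \<ge> 0"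
  shows "interval_cone a b f"
  using assms(2)
proof (induction "degree f" arbitrary: f rule: less_induct)
  case less
  note nonneg = less.prems
  show ?case
  proof (cases "degree f = 0")
    case True
    then obtain c where f: "f = [:c:]" by (rule degree_eq_zeroE)
    then have "c \<ge> 0" using nonneg[of a] assms(1) by simp
    then show ?thesis unfolding f by (rule interval_cone_const)
  next
    case False
    have split: ?thesis
      if fgh: "f = g * h" and g: "interval_cone a b g" "degree g > 0"
        and h: "\<And>t. t \<in> {a..b} \<Longrightarrow> poly h t \<ge> 0" for g h
    proof -
      have "f \<noteq> 0" using False by auto
      then have "g \<noteq> 0" "h \<noteq> 0" using fgh by auto
      then have "degree h < degree f"
        using fgh g(2) by (simp add: degree_mult_eq)
      then have "interval_cone a b h"
        using h by (rule less.hyps)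
      then show ?thesis unfolding fgh by (rule interval_cone_mult[OF g(1)])
    qed
    have "degree (map_poly complex_of_real f) > 0"
      using False by (simp add: degree_map_poly)
    then have "\<exists>z. poly (map_poly complex_of_real f) z = 0"
      by (rule alg_closed_imp_poly_has_root)
    then obtain z where z: "poly (map_poly complex_of_real f) z = 0" ..
    show ?thesis
    proof (cases "Im z = 0")
      case False
      define q where "q = [:(Re z)\<^sup>2 + (Im z)\<^sup>2, - 2 * Re z, 1:]"
      obtain h where h: "f = q * h"
        using real_poly_quadratic_factor[OF z False] unfolding q_def by (rule dvdE)
      have q_sq: "q = [:- Re z, 1:]\<^sup>2 + [:Im z:]\<^sup>2"
        by (simp add: q_def power2_eq_square)
      have q_pos: "poly q t > 0" for t
        using False unfolding q_sq by (simp add: sum_power2_gt_zero_iff)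
      have "poly h t \<ge> 0" if "t \<in> {a..b}" for t
        by (rule nonneg_of_pos_mult[OF _ q_pos[of t]]) (use nonneg[OF that] in \<open>simp add: h\<close>)
      moreover have "interval_cone a b q"
        unfolding q_sq by (intro interval_cone.add interval_cone_square)
      moreover have "degree q > 0"
        by (simp add: q_def)
      ultimately show ?thesis
        using split[OF h] by simp
    next
      case True
      define c where "c = Re z"
      have "z = of_real c" using True by (simp add: c_def complex_eq_iff)
      then have "poly f c = 0" using z by (simp add: poly_map_poly_of_real)
      then obtain h where h: "f = [:- c, 1:] * h"
        unfolding poly_eq_0_iff_dvd by (rule dvdE)
      consider "c \<le> a" | "c \<ge> b" | "a < c" "c < b" by linarith
      then show ?thesis
      proof cases
        case 1
        have eq: "[:- c, 1:] = [:- a, 1:] + [:a - c:]" by simp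
        have "interval_cone a b [:- c, 1:]"
          unfolding eq using 1 by (intro interval_cone.add interval_cone_left interval_cone_const) simp
        moreover have "poly h t \<ge> 0" if "t \<in> {a..b}" for t
        proof (rule poly_nonneg_except_point[OF assms(1) _ that])
          fix t assume t: "t \<in> {a..b}" "t \<noteq> c"
          then have "(t - c) * poly h t \<ge> 0" "t - c > 0"
            using nonneg[OF t(1)] 1 by (auto simp: h algebra_simps)
          then show "poly h t \<ge> 0" by (rule nonneg_of_pos_mult)
        qed
        ultimately show ?thesis using split[OF h] by simp
      next
        case 2
        have eq: "[:c, - 1:] = [:b, - 1:] + [:c - b:]" by simp
        have "interval_cone a b [:c, - 1:]"
          unfolding eq using 2 by (intro interval_cone.add interval_cone_right interval_cone_const) simp
        moreover have "poly (- h) t \<ge> 0" if "t \<in> {a..b}" for t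
        proof (rule poly_nonneg_except_point[OF assms(1) _ that])
          fix t assume t: "t \<in> {a..b}" "t \<noteq> c"
          then have "(c - t) * poly (- h) t \<ge> 0" "c - t > 0"
            using nonneg[OF t(1)] 2 by (auto simp: h algebra_simps)
          then show "poly (- h) t \<ge> 0" by (rule nonneg_of_pos_mult)
        qed
        moreover have "f = [:c, - 1:] * (- h)"
          unfolding h by simp
        ultimately show ?thesis using split[of "[:c, - 1:]" "- h"] by simp
      next
        case 3
        have pos: "poly h t \<ge> 0" if "t \<in> {c..b}" for t
        proof (rule poly_nonneg_except_point[OF 3(2) _ that])
          fix t assume t: "t \<in> {c..b}" "t \<noteq> c"
          then have "(t - c) * poly h t \<ge> 0" "t - c > 0"
            using nonneg[of t] 3 by (auto simp: h algebra_simps)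
          then show "poly h t \<ge> 0" by (rule nonneg_of_pos_mult)
        qed
        have neg: "poly (- h) t \<ge> 0" if "t \<in> {a..c}" for t
        proof (rule poly_nonneg_except_point[OF 3(1) _ that])
          fix t assume t: "t \<in> {a..c}" "t \<noteq> c"
          then have "(c - t) * poly (- h) t \<ge> 0" "c - t > 0"
            using nonneg[of t] 3 by (auto simp: h algebra_simps)
          then show "poly (- h) t \<ge> 0" by (rule nonneg_of_pos_mult)
        qed
        \<comment> \<open>The cofactor is nonnegative to the right of \<open>c\<close> and
          nonpositive to the left, so an interior root is at least double.\<close>
        have "poly h c = 0"
          using pos[of c] neg[of c] 3 by simp
        then obtain k where k: "h = [:- c, 1:] * k"
          unfolding poly_eq_0_iff_dvd by (rule dvdE)
        have f: "f = [:- c, 1:]\<^sup>2 * k"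
          using h unfolding k by (simp only: power2_eq_square mult.assoc)
        have "poly k t \<ge> 0" if "t \<in> {a..b}" for t
        proof (rule poly_nonneg_except_point[OF assms(1) _ that])
          fix t assume t: "t \<in> {a..b}" "t \<noteq> c"
          have "(t - c)\<^sup>2 * poly k t \<ge> 0"
            using nonneg[OF t(1)] unfolding f by simp
          moreover have "(t - c)\<^sup>2 > 0"
            using t(2) by simp
          ultimately show "poly k t \<ge> 0" by (rule nonneg_of_pos_mult)
        qed
        then show ?thesis
        proof (rule split[OF f interval_cone_square, rotated])
          show "degree ([:- c, 1:]\<^sup>2) > 0"
          unfolding power2_eq_square by (subst degree_mult_eq) simp_all
        qed
      qed
    qed
  qed
qed

section \<open>Functional calculus relative to a positive operator\<close>

text \<open>Cauchy-Schwarz for \<open>[H x, y]\<close> at \<open>y = fsym (H x)\<close>, divided by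
  \<open>(knorm (H x))\<^sup>2\<close>. It lets estimates in the seminorm of \<open>H\<close>
  control the norm of \<open>H x\<close>.\<close>

lemma positive_operator_norm_bound:
  assumes "bounded_operator H" "kpositive H"
  shows "\<exists>K\<ge>0. \<forall>x. (knorm (H x))\<^sup>2 \<le> K * Re (kform (H x) x)"
proof -
  obtain C where C: "C \<ge> 0" "\<And>x. knorm (H x) \<le> C * knorm x"
    using bounded_operator_bound[OF assms(1)] by blast
  have nonneg: "Re (kform (H x) x) \<ge> 0" for x
    using assms(2) by (simp add: kpositive_iff)
  have "(knorm (H x))\<^sup>2 \<le> C * Re (kform (H x) x)" for x
  proof (cases "H x = 0")
    case True
    then show ?thesis by simp
  next
    case False
    define y where "y = fsym (H x)"
    have "(knorm (H x))\<^sup>2 \<le> cmod (kform (H x) y)"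
      unfolding knorm_sq y_def fsym_adjoint by (rule complex_Re_le_cmod)
    then have "((knorm (H x))\<^sup>2)\<^sup>2 \<le> (cmod (kform (H x) y))\<^sup>2"
      by (rule power_mono) simp
    also have "\<dots> \<le> Re (kform (H x) x) * Re (kform (H y) y)"
      by (rule kpositive_cauchy_schwarz[OF bounded_operator_clinear[OF assms(1)] assms(2)])
    also have "Re (kform (H y) y) \<le> C * (knorm (H x))\<^sup>2"
    proof -
      have "Re (kform (H y) y) \<le> knorm (H y) * knorm y"
        using complex_Re_le_cmod kform_bound by (rule order_trans)
      also have "\<dots> \<le> C * knorm y * knorm y"
        by (rule mult_right_mono[OF C(2)]) simp
      finally show ?thesis by (simp add: y_def power2_eq_square)
    qed
    then have "Re (kform (H x) x) * Re (kform (H y) y)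
        \<le> Re (kform (H x) x) * (C * (knorm (H x))\<^sup>2)"
      by (rule mult_left_mono[OF _ nonneg])
    finally have "(knorm (H x))\<^sup>2 * (knorm (H x))\<^sup>2 \<le> (C * Re (kform (H x) x)) * (knorm (H x))\<^sup>2"
      by (simp add: power2_eq_square mult_ac)
    then show ?thesis
      by (rule mult_right_le_imp_le) (use False in simp)
  qed
  then show ?thesis using C(1) by blast
qed

text \<open>The growth rate of \<open>[H T^n x, T^n x]\<close> is bounded by the norm of \<open>T\<close>, and this
  sequence is logarithmically convex, so its first quotient is bounded as well.\<close>

lemma selfadjoint_relative_bound:
  assumes bH: "bounded_operator H" and pH: "kpositive H"
    and bT: "bounded_operator T" and sT: "kselfadjoint T" and HT: "\<And>x. H (T x) = T (H x)"
  shows "\<exists>r>0. \<forall>x. \<bar>Re (kform (H (T x)) x)\<bar> \<le> r * Re (kform (H x) x)"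
proof -
  obtain C where C: "C \<ge> 0" "\<And>x. knorm (H x) \<le> C * knorm x"
    using bounded_operator_bound[OF bH] by blast
  obtain D where D: "D \<ge> 0" "\<And>x. knorm (T x) \<le> D * knorm x"
    using bounded_operator_bound[OF bT] by blast
  \<comment> \<open>Adding 1 makes \<open>r\<close> positive, so that dividing by
    \<open>r\<^sup>2\<close> is legitimate.\<close>
  define r where "r = D + 1"
  have r: "r > 0" "r \<noteq> 0" using D(1) by (auto simp: r_def)
  have T_r: "knorm (T x) \<le> r * knorm x" for x
    using D(2)[of x] by (simp add: r_def distrib_right add_increasing2)
  define h where "h x = Re (kform (H x) x)" for x
  have h_nonneg: "h x \<ge> 0" for x
    using pH by (simp add: kpositive_iff h_def)
  have h_le: "h x \<le> C * (knorm x)\<^sup>2" for x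
  proof -
    have "h x \<le> knorm (H x) * knorm x"
      unfolding h_def using complex_Re_le_cmod kform_bound by (rule order_trans)
    also have "\<dots> \<le> C * knorm x * knorm x"
      by (rule mult_right_mono[OF C(2)]) simp
    finally show ?thesis by (simp add: power2_eq_square)
  qed
  have T_sym: "kform (T x) y = kform x (T y)" for x y
    using sT by (simp add: kselfadjoint_def is_kadjoint_def)
  note cs = kpositive_cauchy_schwarz[OF bounded_operator_clinear[OF bH] pH]
  have convex: "(h (T x))\<^sup>2 \<le> h x * h (T (T x))" for x
  proof -
    have "(h (T x))\<^sup>2 \<le> (cmod (kform (H (T x)) (T x)))\<^sup>2"
      using h_nonneg[of "T x"] unfolding h_def
      by (intro power_mono complex_Re_le_cmod)
    also have "kform (H (T x)) (T x) = kform (H x) (T (T x))"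
      by (simp add: HT T_sym)
    also have "(cmod (kform (H x) (T (T x))))\<^sup>2 \<le> h x * h (T (T x))"
      unfolding h_def by (rule cs)
    finally show ?thesis .
  qed
  have main: "h (T x) \<le> r\<^sup>2 * h x" for x
  proof (rule ccontr)
    assume "\<not> h (T x) \<le> r\<^sup>2 * h x"
    then have gt: "h (T x) > r\<^sup>2 * h x" by simp
    have h0: "h x > 0"
    proof (rule ccontr)
      assume "\<not> h x > 0"
      then have "h x = 0" using h_nonneg[of x] by simp
      then show False using convex[of x] gt by simp
    qed
    define q where "q = h (T x) / h x"
    have q: "q > r\<^sup>2" using gt h0 by (simp add: q_def field_simps)
    then have q0: "q > 0" using zero_le_power2[of r] by linarith
    have step: "h ((T ^^ n) x) > 0 \<and> h ((T ^^ Suc n) x) \<ge> q * h ((T ^^ n) x)" for n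
    proof (induction n)
      case 0
      then show ?case using h0 by (simp add: q_def)
    next
      case (Suc n)
      define u where "u = (T ^^ n) x"
      have IH: "h u > 0" "h (T u) \<ge> q * h u"
        using Suc by (auto simp: u_def)
      then have pos: "h (T u) > 0"
        using q0 mult_pos_pos[of q "h u"] by linarith
      have "q * h u * h (T u) \<le> h (T u) * h (T u)"
        using IH(2) pos by (intro mult_right_mono) auto
      also have "\<dots> \<le> h u * h (T (T u))"
        using convex[of u] by (simp add: power2_eq_square)
      finally have "h u * (q * h (T u)) \<le> h u * h (T (T u))"
        by (simp add: mult_ac)
      then have "q * h (T u) \<le> h (T (T u))"
        using IH(1) by simp
      then show ?case using pos by (simp add: u_def)
    qed
    have lower: "q ^ n * h x \<le> h ((T ^^ n) x)" for n
    proof (induction n)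
      case (Suc n)
      have "q ^ Suc n * h x \<le> q * h ((T ^^ n) x)"
        using Suc q0 by (simp add: mult.assoc)
      also have "\<dots> \<le> h ((T ^^ Suc n) x)" using step[of n] by blast
      finally show ?case .
    qed simp
    have growth: "knorm ((T ^^ n) x) \<le> r ^ n * knorm x" for n
    proof (induction n)
      case (Suc n)
      have "knorm ((T ^^ Suc n) x) \<le> r * knorm ((T ^^ n) x)" using T_r by simp
      also have "\<dots> \<le> r * (r ^ n * knorm x)"
        using Suc r by (intro mult_left_mono) auto
      finally show ?case by (simp add: mult.assoc)
    qed simp
    have "(q / r\<^sup>2) ^ n \<le> C * (knorm x)\<^sup>2 / h x" for n
    proof -
      have "q ^ n * h x \<le> C * (knorm ((T ^^ n) x))\<^sup>2"
        using lower h_le by (rule order_trans)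
      also have "\<dots> \<le> C * (r ^ n * knorm x)\<^sup>2"
        using growth C(1) by (intro mult_left_mono power_mono) auto
      finally have "q ^ n * h x \<le> C * (knorm x)\<^sup>2 * (r\<^sup>2) ^ n"
        by (simp add: power_mult_distrib power_mult[symmetric] mult_ac)
      then show ?thesis
        using h0 r by (simp add: power_divide divide_le_eq le_divide_eq mult_ac)
    qed
    moreover have "q / r\<^sup>2 > 1" using q r by simp
    ultimately show False
      using real_arch_pow[of "q / r\<^sup>2" "C * (knorm x)\<^sup>2 / h x"] by (meson not_le)
  qed
  have "\<bar>Re (kform (H (T x)) x)\<bar> \<le> r * h x" for x
  proof (rule power2_le_imp_le[OF order_trans])
    show "\<bar>Re (kform (H (T x)) x)\<bar>\<^sup>2 \<le> (cmod (kform (H (T x)) x))\<^sup>2"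
      by (intro power_mono abs_Re_le_cmod) simp
    have "(cmod (kform (H (T x)) x))\<^sup>2 \<le> h (T x) * h x"
      unfolding h_def by (rule cs)
    also have "\<dots> \<le> (r * h x)\<^sup>2"
      using mult_right_mono[OF main h_nonneg, of x x] by (simp add: power2_eq_square mult_ac)
    finally show "(cmod (kform (H (T x)) x))\<^sup>2 \<le> (r * h x)\<^sup>2" .
    show "0 \<le> r * h x" using r h_nonneg by simp
  qed
  then show ?thesis using r unfolding h_def by blast
qed

text \<open>\<open>H\<close> supplies a possibly degenerate semi-inner product, for which
  \<open>T\<close> is symmetric with numerical range in \<open>[a, b]\<close>. The instances below
  are \<open>(p(A), A)\<close>, the pair of a Gram operator and its square, and plus or minus the
  identity together with \<open>A\<close>.\<close>

locale positive_pair =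
  fixes H T :: "'a::krein_space \<Rightarrow> 'a" and a b :: real
  assumes bH: "bounded_operator H" and bT: "bounded_operator T"
    and pH: "kpositive H" and sT: "kselfadjoint T" and HT: "H (T x) = T (H x)"
    and ab: "a < b"
    and lower: "a * Re (kform (H x) x) \<le> Re (kform (H (T x)) x)"
    and upper: "Re (kform (H (T x)) x) \<le> b * Re (kform (H x) x)"
begin

lemmas lH = bounded_operator_clinear[OF bH]
lemmas lT = bounded_operator_clinear[OF bT]
lemmas H_simps = clinear_simps[OF lH]

lemma H_rop: "H (rop f T x) = rop f T (H x)"
  by (rule rop_commute[OF lT lH HT])

text \<open>Stands in for the integral of \<open>f\<close> against the scalar spectral measure of
  \<open>T\<close> at \<open>x\<close>, in the semi-inner product given by \<open>H\<close>.\<close>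

definition energy :: "real poly \<Rightarrow> 'a \<Rightarrow> real" where
  "energy f x = Re (kform (H (rop f T x)) x)"

lemma energy_one: "energy 1 x = Re (kform (H x) x)"
  unfolding energy_def rop_one[OF lT] ..

lemma energy_one_nonneg: "energy 1 x \<ge> 0"
  using pH by (simp add: energy_one kpositive_iff)

lemma energy_add: "energy (f + g) x = energy f x + energy g x"
  by (simp add: energy_def rop_add[OF lT] H_simps kform_simps)

lemma energy_diff: "energy (f - g) x = energy f x - energy g x"
  by (simp add: energy_def rop_diff[OF lT] H_simps kform_simps)

lemma energy_smult: "energy (smult c f) x = c * energy f x"
  by (simp add: energy_def rop_smult[OF lT] H_simps kform_simps)

lemma energy_const: "energy [:c:] x = c * energy 1 x"
  using energy_smult[of c 1 x] by (simp add: one_pCons)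

text \<open>\<open>s(T)\<close> commutes with \<open>H\<close> and is symmetric, so one of the two
  factors \<open>s\<close> can be moved to the other argument of the form.\<close>

lemma energy_mult_square: "energy (f * s\<^sup>2) x = energy f (rop s T x)"
proof -
  have eq: "f * s\<^sup>2 = s * (f * s)"
    by (simp add: power2_eq_square)
  have "H (rop (f * s\<^sup>2) T x) = rop s T (H (rop f T (rop s T x)))"
    unfolding eq by (simp only: rop_mult[OF lT] H_rop)
  then show ?thesis
    by (simp add: energy_def rop_adjoint[OF lT sT])
qed

lemma energy_left: "energy [:- a, 1:] x \<ge> 0"
  using lower[of x] by (simp add: energy_def rop_linear[OF lT] H_simps kform_simps scaleC_one)

lemma energy_right: "energy [:b, - 1:] x \<ge> 0"
  using upper[of x] by (simp add: energy_def rop_linear[OF lT] H_simps kform_simps scaleC_one)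

text \<open>Nonnegativity of a product of two nonnegative commuting factors is not immediate. The
  identity \<open>(b - a)(t - a)(b - t) = (t - a)(b - t)^2 + (b - t)(t - a)^2\<close> reduces it to
  the single factors applied to other vectors.\<close>

lemma energy_left_right: "energy ([:- a, 1:] * [:b, - 1:]) x \<ge> 0"
proof -
  have "smult (b - a) ([:- a, 1:] * [:b, - 1:])
      = [:- a, 1:] * [:b, - 1:]\<^sup>2 + [:b, - 1:] * [:- a, 1:]\<^sup>2"
    by (simp add: power2_eq_square) (intro conjI; algebra)
  then have "energy (smult (b - a) ([:- a, 1:] * [:b, - 1:])) x
      = energy ([:- a, 1:] * [:b, - 1:]\<^sup>2 + [:b, - 1:] * [:- a, 1:]\<^sup>2) x"
    by (simp only:)
  then have "(b - a) * energy ([:- a, 1:] * [:b, - 1:]) x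
      = energy [:- a, 1:] (rop [:b, - 1:] T x) + energy [:b, - 1:] (rop [:- a, 1:] T x)"
    unfolding energy_smult energy_add energy_mult_square .
  also have "\<dots> \<ge> 0"
    by (intro add_nonneg_nonneg energy_left energy_right)
  finally show ?thesis
    by (rule nonneg_of_pos_mult) (use ab in simp)
qed

lemma energy_nonneg:
  assumes "\<And>t. t \<in> {a..b} \<Longrightarrow> poly f t \<ge> 0"
  shows "energy f x \<ge> 0"
proof -
  have "interval_cone a b f"
    using ab assms by (rule interval_cone_of_nonneg)
  then show ?thesis
  proof (induction rule: interval_cone.induct)
    case (gen i j s)
    \<comment> \<open>Even powers are absorbed into the square \<open>v\<^sup>2\<close>; the
      parities leave only the four weights \<open>1\<close>, \<open>t - a\<close>,
      \<open>b - t\<close> and \<open>(t - a)(b - t)\<close>.\<close>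
    define w where "w = [:- a, 1:] ^ (i mod 2) * [:b, - 1:] ^ (j mod 2)"
    define v where "v = [:- a, 1:] ^ (i div 2) * [:b, - 1:] ^ (j div 2) * s"
    have pow: "p ^ k = p ^ (k mod 2) * (p ^ (k div 2))\<^sup>2" for p :: "real poly" and k
      unfolding power_mult[symmetric] power_add[symmetric] by (simp add: mult.commute)
    have eq: "[:- a, 1:] ^ i * [:b, - 1:] ^ j * s\<^sup>2 = w * v\<^sup>2"
      unfolding pow[of _ i] pow[of _ j] w_def v_def power_mult_distrib by (simp only: mult_ac)
    have "energy w y \<ge> 0" for y
    proof -
      have "i mod 2 = 0 \<or> i mod 2 = 1" "j mod 2 = 0 \<or> j mod 2 = 1" by auto
      then show ?thesis
        unfolding w_def
        by (elim disjE)
          (simp_all only: power_0 power_one_right mult_1_left mult_1_right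
            energy_left energy_right energy_left_right energy_one_nonneg)
    qed
    then show ?case unfolding eq energy_mult_square .
  next
    case (add p q)
    then show ?case by (simp add: energy_add)
  qed
qed

lemma energy_mono:
  assumes "\<And>t. t \<in> {a..b} \<Longrightarrow> poly f t \<le> poly g t"
  shows "energy f x \<le> energy g x"
  using energy_nonneg[of "g - f" x] assms by (simp add: energy_diff)

definition hconst :: real where
  "hconst = (SOME K. K \<ge> 0 \<and> (\<forall>x. (knorm (H x))\<^sup>2 \<le> K * Re (kform (H x) x)))"

lemma hconst: "hconst \<ge> 0" "(knorm (H x))\<^sup>2 \<le> hconst * energy 1 x"
proof -
  have "hconst \<ge> 0 \<and> (\<forall>x. (knorm (H x))\<^sup>2 \<le> hconst * Re (kform (H x) x))"
    unfolding hconst_def by (rule someI_ex) (rule positive_operator_norm_bound[OF bH pH])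
  then show "hconst \<ge> 0" "(knorm (H x))\<^sup>2 \<le> hconst * energy 1 x"
    unfolding energy_one by blast+
qed

lemma knorm_rop_sq: "(knorm (H (rop f T x)))\<^sup>2 \<le> hconst * energy (f\<^sup>2) x"
  using hconst(2)[of "rop f T x"] energy_mult_square[of 1 f x] by simp

text \<open>Scaled by \<open>hconst\<close> so that the norm of \<open>H f(T) x\<close> is at most
  the supremum of \<open>\<bar>f\<bar>\<close> on \<open>[a, b]\<close> times
  \<open>hnorm x\<close>. It is only a seminorm.\<close>

definition hnorm :: "'a \<Rightarrow> real" where
  "hnorm x = sqrt (hconst * energy 1 x)"

lemma hnorm_nonneg: "hnorm x \<ge> 0"
  by (simp add: hnorm_def hconst energy_one_nonneg)

lemma knorm_rop_le:
  assumes "\<And>t. t \<in> {a..b} \<Longrightarrow> \<bar>poly f t\<bar> \<le> e" "e \<ge> 0"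
  shows "knorm (H (rop f T x)) \<le> e * hnorm x"
proof (rule power2_le_imp_le)
  have "energy (f\<^sup>2) x \<le> energy [:e\<^sup>2:] x"
  proof (rule energy_mono)
    fix t assume "t \<in> {a..b}"
    then have "\<bar>poly f t\<bar>\<^sup>2 \<le> e\<^sup>2" using assms by (intro power_mono) auto
    then show "poly (f\<^sup>2) t \<le> poly [:e\<^sup>2:] t" by simp
  qed
  then have "hconst * energy (f\<^sup>2) x \<le> hconst * (e\<^sup>2 * energy 1 x)"
    unfolding energy_const by (intro mult_left_mono hconst(1))
  then have "(knorm (H (rop f T x)))\<^sup>2 \<le> hconst * (e\<^sup>2 * energy 1 x)"
    using knorm_rop_sq[of f x] by (rule order_trans[rotated])
  also have "\<dots> = (e * hnorm x)\<^sup>2"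
    by (simp add: hnorm_def power_mult_distrib hconst energy_one_nonneg)
  finally show "(knorm (H (rop f T x)))\<^sup>2 \<le> (e * hnorm x)\<^sup>2" .
  show "0 \<le> e * hnorm x" using assms(2) hnorm_nonneg by simp
qed

end

section \<open>Uniform approximation by polynomials\<close>

definition poly_approx :: "real \<Rightarrow> real \<Rightarrow> (nat \<Rightarrow> real poly) \<Rightarrow> (real \<Rightarrow> real) \<Rightarrow> bool" where
  "poly_approx a b F f \<longleftrightarrow> uniform_limit {a..b} (\<lambda>n. poly (F n)) f sequentially"

lemma poly_approxD:
  assumes "poly_approx a b F f" "e > 0"
  shows "\<exists>N. \<forall>n\<ge>N. \<forall>t\<in>{a..b}. \<bar>poly (F n) t - f t\<bar> < e"
  using uniform_limitD[OF assms[unfolded poly_approx_def]]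
  unfolding eventually_sequentially dist_real_def .

lemma poly_approx_exists:
  assumes "continuous_on {a..b} f"
  shows "\<exists>F. poly_approx a b F f"
proof -
  have "\<exists>p. \<forall>t\<in>{a..b}. \<bar>poly p t - f t\<bar> < 1 / real (Suc n)" for n
  proof -
    obtain g where g: "real_polynomial_function g" "\<And>t. t \<in> {a..b} \<Longrightarrow> \<bar>f t - g t\<bar> < 1 / real (Suc n)"
      using Stone_Weierstrass_real_polynomial_function[OF compact_Icc assms, of "1 / real (Suc n)"]
      by auto
    obtain c m where "g = (\<lambda>x. \<Sum>i\<le>m. c i * x ^ i)"
      using g(1) unfolding real_polynomial_function_iff_sum by blast
    then have "poly (\<Sum>i\<le>m. monom (c i) i) t = g t" for t
      by (simp add: poly_sum poly_monom)
    then show ?thesis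
      using g(2) by (intro exI[of _ "\<Sum>i\<le>m. monom (c i) i"]) (simp add: abs_minus_commute)
  qed
  then obtain F where F: "\<And>n t. t \<in> {a..b} \<Longrightarrow> \<bar>poly (F n) t - f t\<bar> < 1 / real (Suc n)"
    by metis
  have "poly_approx a b F f"
    unfolding poly_approx_def uniform_limit_iff dist_real_def
  proof (intro allI impI)
    fix e :: real assume "e > 0"
    then obtain N where N: "1 / real (Suc N) < e"
      using nat_approx_posE by metis
    show "\<forall>\<^sub>F n in sequentially. \<forall>t\<in>{a..b}. \<bar>poly (F n) t - f t\<bar> < e"
      unfolding eventually_sequentially
    proof (intro exI[of _ N] allI impI ballI)
      fix n t assume "n \<ge> N" "t \<in> {a..b}"
      then have "1 / real (Suc n) \<le> 1 / real (Suc N)"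
        by (intro divide_left_mono) auto
      then show "\<bar>poly (F n) t - f t\<bar> < e"
        using F[OF \<open>t \<in> {a..b}\<close>, of n] N by linarith
    qed
  qed
  then show ?thesis by blast
qed

lemma poly_approx_poly: "poly_approx a b (\<lambda>n. p) (poly p)"
  by (simp add: poly_approx_def uniform_limit_const)

lemma poly_approx_add:
  assumes "poly_approx a b F f" "poly_approx a b G g"
  shows "poly_approx a b (\<lambda>n. F n + G n) (\<lambda>t. f t + g t)"
  using uniform_limit_add[OF assms[unfolded poly_approx_def]]
  by (simp add: poly_approx_def poly_add[abs_def])

lemma poly_approx_diff:
  assumes "poly_approx a b F f" "poly_approx a b G g"
  shows "poly_approx a b (\<lambda>n. F n - G n) (\<lambda>t. f t - g t)"
  using uniform_limit_minus[OF assms[unfolded poly_approx_def]]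
  by (simp add: poly_approx_def poly_diff[abs_def])

lemma poly_approx_mult:
  assumes "poly_approx a b F f" "poly_approx a b G g" "continuous_on {a..b} f" "continuous_on {a..b} g"
  shows "poly_approx a b (\<lambda>n. F n * G n) (\<lambda>t. f t * g t)"
proof -
  have "bounded (f ` {a..b})" "bounded (g ` {a..b})"
    using assms(3,4) by (auto intro!: compact_imp_bounded compact_continuous_image)
  then show ?thesis
    using uniform_lim_mult[OF assms(1,2)[unfolded poly_approx_def]]
    by (simp add: poly_approx_def poly_mult[abs_def])
qed

lemma poly_approx_cong:
  assumes "\<And>t. t \<in> {a..b} \<Longrightarrow> f t = g t"
  shows "poly_approx a b F f \<longleftrightarrow> poly_approx a b F g"
  unfolding poly_approx_def using assms by (intro uniform_limit_cong') auto

section \<open>Continuous functional calculus\<close>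

context positive_pair
begin

lemma kconv_approx_zero:
  assumes "poly_approx a b F (\<lambda>_. 0)"
  shows "kconv (\<lambda>n. H (rop (F n) T x)) 0"
  unfolding kconv_def
proof (rule LIMSEQ_I)
  fix r :: real assume r: "r > 0"
  \<comment> \<open>The summand 1 keeps the divisor positive, since \<open>hnorm x\<close> can
    vanish.\<close>
  define e where "e = r / (hnorm x + 1)"
  have pos: "hnorm x + 1 > 0" using hnorm_nonneg[of x] by simp
  have e: "e > 0" "e * hnorm x < r"
    using r pos hnorm_nonneg[of x] by (auto simp: e_def field_simps)
  obtain N where N: "\<forall>n\<ge>N. \<forall>t\<in>{a..b}. \<bar>poly (F n) t - 0\<bar> < e"
    using poly_approxD[OF assms e(1)] by blast
  have "knorm (H (rop (F n) T x)) < r" if "n \<ge> N" for n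
  proof -
    have "knorm (H (rop (F n) T x)) \<le> e * hnorm x"
    proof (rule knorm_rop_le)
      fix t assume "t \<in> {a..b}"
      then show "\<bar>poly (F n) t\<bar> \<le> e"
        using N[rule_format, OF that, of t] by simp
    qed (use e(1) in simp)
    then show ?thesis using e(2) by linarith
  qed
  then show "\<exists>N. \<forall>n\<ge>N. norm (knorm (H (rop (F n) T x) - 0) - 0) < r"
    by (intro exI[of _ N]) auto
qed

text \<open>\<open>fc f\<close> is \<open>f(T) H\<close>, since \<open>f(T)\<close> alone does not exist in general; it is
  meaningful only for \<open>f\<close> continuous on \<open>[a, b]\<close>.\<close>

definition fc :: "(real \<Rightarrow> real) \<Rightarrow> 'a \<Rightarrow> 'a" where
  "fc f x = (SOME y. \<forall>F. poly_approx a b F f \<longrightarrow> kconv (\<lambda>n. H (rop (F n) T x)) y)"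

text \<open>By \<open>knorm_rop_le\<close> a uniformly Cauchy sequence of polynomials gives a Cauchy
  sequence of vectors. Two approximating sequences differ by one that tends uniformly to zero, so a
  single vector serves all sequences over which \<open>fc\<close> quantifies.\<close>

lemma fc_limit:
  assumes "continuous_on {a..b} f" "poly_approx a b F f"
  shows "kconv (\<lambda>n. H (rop (F n) T x)) (fc f x)"
proof -
  have "\<exists>y. kconv (\<lambda>n. H (rop (F n) T x)) y"
  proof (rule kconv_complete)
    fix r :: real assume r: "r > 0"
    define e where "e = r / (2 * (hnorm x + 1))"
    have pos: "hnorm x + 1 > 0" using hnorm_nonneg[of x] by simp
    have e: "e > 0" "2 * e * hnorm x < r"
      using r pos hnorm_nonneg[of x] by (auto simp: e_def field_simps)
    obtain N where N: "\<forall>n\<ge>N. \<forall>t\<in>{a..b}. \<bar>poly (F n) t - f t\<bar> < e"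
      using poly_approxD[OF assms(2) e(1)] by blast
    have "knorm (H (rop (F m) T x) - H (rop (F n) T x)) < r" if "m \<ge> N" "n \<ge> N" for m n
    proof -
      have "knorm (H (rop (F m - F n) T x)) \<le> 2 * e * hnorm x"
      proof (rule knorm_rop_le)
        fix t assume "t \<in> {a..b}"
        then have "\<bar>poly (F m) t - f t\<bar> < e" "\<bar>poly (F n) t - f t\<bar> < e"
          using N[rule_format] that by simp_all
        then show "\<bar>poly (F m - F n) t\<bar> \<le> 2 * e" by simp
      qed (use e in auto)
      then show ?thesis using e(2) by (simp add: rop_diff[OF lT] H_simps)
    qed
    then show "\<exists>N. \<forall>m\<ge>N. \<forall>n\<ge>N. knorm (H (rop (F m) T x) - H (rop (F n) T x)) < r"
      by blast
  qed
  then obtain y where y: "kconv (\<lambda>n. H (rop (F n) T x)) y" ..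
  have "kconv (\<lambda>n. H (rop (G n) T x)) y" if "poly_approx a b G f" for G
  proof (rule kconv_cong_diff[OF y])
    have "poly_approx a b (\<lambda>n. F n - G n) (\<lambda>t. 0)"
      using poly_approx_diff[OF assms(2) that] by simp
    then show "kconv (\<lambda>n. H (rop (F n) T x) - H (rop (G n) T x)) 0"
      using kconv_approx_zero[of "\<lambda>n. F n - G n" x] by (simp add: rop_diff[OF lT] H_simps)
  qed
  then have "\<exists>y. \<forall>F. poly_approx a b F f \<longrightarrow> kconv (\<lambda>n. H (rop (F n) T x)) y"
    by blast
  from someI_ex[OF this] show ?thesis
    unfolding fc_def using assms(2) by blast
qed

lemma fc_unique:
  assumes "continuous_on {a..b} f" "poly_approx a b F f" "kconv (\<lambda>n. H (rop (F n) T x)) y"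
  shows "fc f x = y"
  using fc_limit[OF assms(1,2)] assms(3) by (rule kconv_unique)

lemma fc_cong:
  assumes "\<And>t. t \<in> {a..b} \<Longrightarrow> f t = g t"
  shows "fc f x = fc g x"
proof -
  have "poly_approx a b F f = poly_approx a b F g" for F
    by (rule poly_approx_cong[OF assms])
  then show ?thesis unfolding fc_def by simp
qed

lemma fc_poly: "fc (poly p) x = H (rop p T x)"
  by (rule fc_unique[OF _ poly_approx_poly]) (auto intro: continuous_intros)

lemma fc_one: "fc (\<lambda>t. 1) x = H x"
proof -
  have "fc (\<lambda>t. 1) x = fc (poly 1) x" by (rule fc_cong) simp
  also have "\<dots> = H x" unfolding fc_poly rop_one[OF lT] ..
  finally show ?thesis .
qed

lemma fc_add:
  assumes "continuous_on {a..b} f" "continuous_on {a..b} g"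
  shows "fc (\<lambda>t. f t + g t) x = fc f x + fc g x"
proof -
  obtain F G where F: "poly_approx a b F f" and G: "poly_approx a b G g"
    using poly_approx_exists assms by meson
  show ?thesis
  proof (rule fc_unique[OF _ poly_approx_add[OF F G]])
    show "continuous_on {a..b} (\<lambda>t. f t + g t)"
      using assms by (rule continuous_on_add)
    show "kconv (\<lambda>n. H (rop (F n + G n) T x)) (fc f x + fc g x)"
      using kconv_add[OF fc_limit[OF assms(1) F] fc_limit[OF assms(2) G], of x x]
      by (simp add: rop_add[OF lT] H_simps)
  qed
qed

lemma fc_commute:
  assumes f: "continuous_on {a..b} f" and Q: "bounded_operator Q"
    and QH: "\<And>x. Q (H x) = H (Q x)" and QT: "\<And>x. Q (T x) = T (Q x)"
  shows "Q (fc f x) = fc f (Q x)"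
proof -
  obtain F where F: "poly_approx a b F f"
    using poly_approx_exists[OF f] by blast
  have "kconv (\<lambda>n. Q (H (rop (F n) T x))) (Q (fc f x))"
    by (rule kconv_bounded_operator[OF Q fc_limit[OF f F]])
  then have "kconv (\<lambda>n. H (rop (F n) T (Q x))) (Q (fc f x))"
    by (simp only: QH rop_commute[OF lT bounded_operator_clinear[OF Q] QT])
  then show ?thesis
    using fc_unique[OF f F] by simp
qed

lemma fc_poly_mult:
  assumes f: "continuous_on {a..b} f"
  shows "fc (\<lambda>t. poly p t * f t) x = rop p T (fc f x)"
proof -
  obtain F where F: "poly_approx a b F f"
    using poly_approx_exists[OF f] by blast
  have cp: "continuous_on {a..b} (poly p)" by (intro continuous_intros)
  have "kconv (\<lambda>n. rop p T (H (rop (F n) T x))) (rop p T (fc f x))"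
    by (rule kconv_bounded_operator[OF bounded_operator_poly_op[OF bT] fc_limit[OF f F]])
  then have "kconv (\<lambda>n. H (rop (p * F n) T x)) (rop p T (fc f x))"
    by (simp only: rop_mult[OF lT] H_rop)
  then show ?thesis
    by (rule fc_unique[OF continuous_on_mult[OF cp f] poly_approx_mult[OF poly_approx_poly F cp f]])
qed

lemma fc_adjoint:
  assumes f: "continuous_on {a..b} f"
  shows "kform (fc f x) y = kform x (fc f y)"
proof -
  obtain F where F: "poly_approx a b F f"
    using poly_approx_exists[OF f] by blast
  \<comment> \<open>\<open>kconv_kform\<close> passes to the limit in the first argument only, hence
    the detour through the conjugate.\<close>
  have "kform (H (rop (F n) T x)) y = cnj (kform (H (rop (F n) T y)) x)" for n
  proof -
    have "kform (H (rop (F n) T x)) y = kform x (H (rop (F n) T y))"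
      by (simp add: kpositive_selfadjoint[OF lH pH] rop_adjoint[OF lT sT] H_rop)
    then show ?thesis by (rule trans[OF _ kform_hermitian])
  qed
  moreover have "(\<lambda>n. cnj (kform (H (rop (F n) T y)) x)) \<longlonglongrightarrow> cnj (kform (fc f y) x)"
    by (intro tendsto_cnj kconv_kform fc_limit[OF f F])
  moreover have "(\<lambda>n. kform (H (rop (F n) T x)) y) \<longlonglongrightarrow> kform (fc f x) y"
    by (intro kconv_kform fc_limit[OF f F])
  ultimately have "kform (fc f x) y = cnj (kform (fc f y) x)"
    by (simp add: LIMSEQ_unique)
  then show ?thesis by (simp add: kform_hermitian[of x "fc f y"])
qed

lemma fc_energy_limit:
  assumes "continuous_on {a..b} f" "poly_approx a b F f"
  shows "(\<lambda>n. energy (F n) x) \<longlonglongrightarrow> Re (kform (fc f x) x)"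
  unfolding energy_def by (intro tendsto_Re kconv_kform fc_limit[OF assms])

lemma fc_nonneg:
  assumes f: "continuous_on {a..b} f" and nonneg: "\<And>t. t \<in> {a..b} \<Longrightarrow> f t \<ge> 0"
  shows "Re (kform (fc f x) x) \<ge> 0"
proof (rule ccontr)
  assume "\<not> ?thesis"
  then have neg: "Re (kform (fc f x) x) < 0" by simp
  obtain F where F: "poly_approx a b F f"
    using poly_approx_exists[OF f] by blast
  \<comment> \<open>The approximating polynomials may dip below zero, but eventually not below
    \<open>- d\<close>. This \<open>d\<close> is so small that the resulting lower bound
    \<open>- d * energy 1 x\<close> still exceeds the supposedly negative limit.\<close>
  define d where "d = - Re (kform (fc f x) x) / (2 * (energy 1 x + 1))"
  have pos: "energy 1 x + 1 > 0" using energy_one_nonneg[of x] by simp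
  have "d * (energy 1 x + 1) = - Re (kform (fc f x) x) / 2"
    using pos by (simp add: d_def field_simps)
  moreover have "d > 0"
    unfolding d_def by (rule divide_pos_pos) (use neg pos in simp_all)
  ultimately have d: "d > 0" "Re (kform (fc f x) x) < - d * energy 1 x"
    using neg by (simp_all add: distrib_left)
  obtain N where N: "\<forall>n\<ge>N. \<forall>t\<in>{a..b}. \<bar>poly (F n) t - f t\<bar> < d"
    using poly_approxD[OF F d(1)] by blast
  have "energy (F n) x \<ge> - d * energy 1 x" if "n \<ge> N" for n
    unfolding energy_const[symmetric]
  proof (rule energy_mono)
    fix t assume "t \<in> {a..b}"
    then show "poly [:- d:] t \<le> poly (F n) t"
      using N that nonneg[of t] by fastforce
  qed
  then have "- d * energy 1 x \<le> Re (kform (fc f x) x)"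
    by (intro LIMSEQ_le_const[OF fc_energy_limit[OF f F]]) blast
  then show False using d(2) by simp
qed

text \<open>Finer than a bound by the supremum of \<open>f\<close>: the square stays inside the
  form, where it can be compared pointwise with other functions. The uniform definiteness of the
  subspaces \<open>g(A) p(A) x = x\<close> rests on this.\<close>

lemma fc_norm_sq:
  assumes f: "continuous_on {a..b} f"
  shows "(knorm (fc f x))\<^sup>2 \<le> hconst * Re (kform (fc (\<lambda>t. f t * f t) x) x)"
proof -
  obtain F where F: "poly_approx a b F f"
    using poly_approx_exists[OF f] by blast
  show ?thesis
  proof (rule LIMSEQ_le)
    show "(\<lambda>n. (knorm (H (rop (F n) T x)))\<^sup>2) \<longlonglongrightarrow> (knorm (fc f x))\<^sup>2"
      by (intro tendsto_power kconv_knorm fc_limit[OF f F])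
    show "(\<lambda>n. hconst * energy (F n * F n) x) \<longlonglongrightarrow> hconst * Re (kform (fc (\<lambda>t. f t * f t) x) x)"
      by (intro tendsto_mult tendsto_const fc_energy_limit poly_approx_mult[OF F F f f]
          continuous_on_mult[OF f f])
    show "\<exists>N. \<forall>n\<ge>N. (knorm (H (rop (F n) T x)))\<^sup>2 \<le> hconst * energy (F n * F n) x"
      using knorm_rop_sq by (auto simp: power2_eq_square)
  qed
qed

lemma fc_scale:
  assumes f: "continuous_on {a..b} f"
  shows "fc (\<lambda>t. c * f t) x = of_real c *\<^sub>C fc f x"
  using fc_poly_mult[OF f, of "[:c:]" x] by (simp add: rop_const[OF lT])

lemma fc_diff:
  assumes "continuous_on {a..b} f" "continuous_on {a..b} g"
  shows "fc (\<lambda>t. f t - g t) x = fc f x - fc g x"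
  using fc_add[OF assms(1) continuous_on_mult[OF continuous_on_const assms(2)], of "- 1" x]
  by (simp add: fc_scale[OF assms(2), of "- 1", simplified] scaleC_one)

lemma fc_mono:
  assumes "continuous_on {a..b} f" "continuous_on {a..b} g" "\<And>t. t \<in> {a..b} \<Longrightarrow> f t \<le> g t"
  shows "Re (kform (fc f x) x) \<le> Re (kform (fc g x) x)"
  using fc_nonneg[OF continuous_on_diff[OF assms(2,1)], of x] assms(3)
  by (simp add: fc_diff[OF assms(2,1)] kform_simps)

lemma fc_norm_le:
  assumes f: "continuous_on {a..b} f" and e: "\<And>t. t \<in> {a..b} \<Longrightarrow> \<bar>f t\<bar> \<le> e" "e \<ge> 0"
  shows "knorm (fc f x) \<le> e * hnorm x"
proof (rule power2_le_imp_le)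
  have "Re (kform (fc (\<lambda>t. f t * f t) x) x) \<le> Re (kform (fc (\<lambda>t. e\<^sup>2 * 1) x) x)"
  proof (rule fc_mono)
    fix t assume "t \<in> {a..b}"
    then have "\<bar>f t\<bar>\<^sup>2 \<le> e\<^sup>2" using e by (intro power_mono) auto
    then show "f t * f t \<le> e\<^sup>2 * 1" by (simp add: power2_eq_square)
  qed (intro continuous_intros f)+
  also have "\<dots> = e\<^sup>2 * energy 1 x"
    unfolding fc_scale[OF continuous_on_const] fc_one kform_scale_left energy_one by simp
  finally have "hconst * Re (kform (fc (\<lambda>t. f t * f t) x) x) \<le> hconst * (e\<^sup>2 * energy 1 x)"
    by (intro mult_left_mono hconst(1))
  with fc_norm_sq[OF f, of x] have "(knorm (fc f x))\<^sup>2 \<le> hconst * (e\<^sup>2 * energy 1 x)"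
    by (rule order_trans)
  also have "\<dots> = (e * hnorm x)\<^sup>2"
    by (simp add: hnorm_def power_mult_distrib hconst energy_one_nonneg)
  finally show "(knorm (fc f x))\<^sup>2 \<le> (e * hnorm x)\<^sup>2" .
  show "0 \<le> e * hnorm x" using e(2) hnorm_nonneg by simp
qed

lemma hnorm_bounded: "\<exists>C\<ge>0. \<forall>x. hnorm x \<le> C * knorm x"
proof -
  obtain C where C: "C \<ge> 0" "\<And>x. knorm (H x) \<le> C * knorm x"
    using bounded_operator_bound[OF bH] by blast
  have "hnorm x \<le> sqrt (hconst * C) * knorm x" for x
  proof -
    have "energy 1 x \<le> knorm (H x) * knorm x"
      unfolding energy_one using complex_Re_le_cmod kform_bound by (rule order_trans)
    also have "\<dots> \<le> C * knorm x * knorm x"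
      by (rule mult_right_mono[OF C(2)]) simp
    finally have "hconst * energy 1 x \<le> hconst * (C * knorm x * knorm x)"
      by (rule mult_left_mono[OF _ hconst(1)])
    then have "hnorm x \<le> sqrt (hconst * (C * knorm x * knorm x))"
      unfolding hnorm_def by (rule real_sqrt_le_mono)
    then show ?thesis by (simp add: real_sqrt_mult mult.assoc)
  qed
  moreover have "sqrt (hconst * C) \<ge> 0"
    using C(1) hconst(1) by simp
  ultimately show ?thesis by blast
qed

lemma continuous_on_interval_bound:
  assumes "continuous_on {a..b} (f :: real \<Rightarrow> real)"
  shows "\<exists>e\<ge>0. \<forall>t\<in>{a..b}. \<bar>f t\<bar> \<le> e"
proof -
  have "bounded (f ` {a..b})"
    using assms by (auto intro!: compact_imp_bounded compact_continuous_image)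
  then obtain e where e: "e > 0" "\<And>t. t \<in> {a..b} \<Longrightarrow> norm (f t) \<le> e"
    unfolding bounded_pos by blast
  then show ?thesis by (intro exI[of _ e]) auto
qed

lemma bounded_operator_fc:
  assumes f: "continuous_on {a..b} f"
  shows "bounded_operator (fc f)"
proof -
  obtain F where F: "poly_approx a b F f"
    using poly_approx_exists[OF f] by blast
  obtain e where e: "e \<ge> 0" "\<And>t. t \<in> {a..b} \<Longrightarrow> \<bar>f t\<bar> \<le> e"
    using continuous_on_interval_bound[OF f] by blast
  obtain C where C: "C \<ge> 0" "\<And>x. hnorm x \<le> C * knorm x"
    using hnorm_bounded by blast
  have lin: "clinear (\<lambda>x. H (rop p T x))" for p
    using bounded_operator_compose[OF bH bounded_operator_poly_op[OF bT]]
    by (rule bounded_operator_clinear)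
  show ?thesis
  proof (rule bounded_operatorI)
    show "fc f (x + y) = fc f x + fc f y" for x y
      using kconv_add[OF fc_limit[OF f F, of x] fc_limit[OF f F, of y]]
      by (intro fc_unique[OF f F]) (simp add: clinear_simps[OF lin])
    show "fc f (c *\<^sub>C x) = c *\<^sub>C fc f x" for c x
    proof (rule fc_unique[OF f F])
      have "kconv (\<lambda>n. c *\<^sub>C H (rop (F n) T x)) (c *\<^sub>C fc f x)"
        by (rule kconv_bounded_operator[OF bounded_operator_scale[OF bounded_operator_ident]
              fc_limit[OF f F]])
      then show "kconv (\<lambda>n. H (rop (F n) T (c *\<^sub>C x))) (c *\<^sub>C fc f x)"
        by (simp add: clinear_simps[OF lin])
    qed
    show "knorm (fc f x) \<le> (e * C) * knorm x" for x
    proof -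
      have "knorm (fc f x) \<le> e * hnorm x"
        using f e(2,1) by (rule fc_norm_le)
      also have "\<dots> \<le> e * (C * knorm x)"
        by (rule mult_left_mono[OF C(2) e(1)])
      finally show ?thesis by (simp add: mult.assoc)
    qed
  qed
qed

text \<open>Each \<open>fc\<close> carries a factor \<open>H\<close>, so the composite
  \<open>f(T) H g(T) H\<close> has one more than the value at the product. Only \<open>f\<close> is
  approximated; \<open>g\<close> stays fixed and bounded.\<close>

lemma fc_fc:
  assumes f: "continuous_on {a..b} f" and g: "continuous_on {a..b} g"
  shows "fc f (fc g x) = H (fc (\<lambda>t. f t * g t) x)"
proof -
  obtain F where F: "poly_approx a b F f"
    using poly_approx_exists[OF f] by blast
  obtain e where e: "e \<ge> 0" "\<And>t. t \<in> {a..b} \<Longrightarrow> \<bar>g t\<bar> \<le> e"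
    using continuous_on_interval_bound[OF g] by blast
  have cF: "continuous_on {a..b} (\<lambda>t. poly p t * g t)" for p
    by (intro continuous_intros g)
  have "kconv (\<lambda>n. fc (\<lambda>t. poly (F n) t * g t) x) (fc (\<lambda>t. f t * g t) x)"
    unfolding kconv_def
  proof (rule LIMSEQ_I)
    fix r :: real assume r: "r > 0"
    define d where "d = r / (e * hnorm x + 1)"
    have pos: "e * hnorm x \<ge> 0" using e(1) hnorm_nonneg[of x] by simp
    have d: "d > 0" "d * e * hnorm x < r"
      using r pos by (auto simp: d_def field_simps add_pos_nonneg)
    obtain N where N: "\<forall>n\<ge>N. \<forall>t\<in>{a..b}. \<bar>poly (F n) t - f t\<bar> < d"
      using poly_approxD[OF F d(1)] by blast
    have "knorm (fc (\<lambda>t. poly (F n) t * g t) x - fc (\<lambda>t. f t * g t) x) < r" if "n \<ge> N" for n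
    proof -
      have "fc (\<lambda>t. poly (F n) t * g t) x - fc (\<lambda>t. f t * g t) x
          = fc (\<lambda>t. poly (F n) t * g t - f t * g t) x"
        by (rule fc_diff[OF cF continuous_on_mult[OF f g], symmetric])
      also have "knorm \<dots> \<le> (d * e) * hnorm x"
      proof (rule fc_norm_le)
        show "continuous_on {a..b} (\<lambda>t. poly (F n) t * g t - f t * g t)"
          by (intro continuous_intros f g)
        fix t assume t: "t \<in> {a..b}"
        have "\<bar>poly (F n) t - f t\<bar> * \<bar>g t\<bar> \<le> d * e"
          using N that t e d(1) by (intro mult_mono) (auto simp: less_imp_le)
        then show "\<bar>poly (F n) t * g t - f t * g t\<bar> \<le> d * e"
          by (simp add: abs_mult left_diff_distrib[symmetric])
      qed (use e d(1) in auto)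
      finally show ?thesis using d(2) by simp
    qed
    then show "\<exists>N. \<forall>n\<ge>N. norm (knorm (fc (\<lambda>t. poly (F n) t * g t) x - fc (\<lambda>t. f t * g t) x) - 0) < r"
      by (intro exI[of _ N]) auto
  qed
  then have "kconv (\<lambda>n. H (fc (\<lambda>t. poly (F n) t * g t) x)) (H (fc (\<lambda>t. f t * g t) x))"
    by (rule kconv_bounded_operator[OF bH])
  then show ?thesis
    unfolding fc_poly_mult[OF g] by (rule fc_unique[OF f F])
qed

end

section \<open>Regular subspaces\<close>

lemma Metric_space_knorm: "Metric_space UNIV (\<lambda>x y. knorm (x - y :: 'a::krein_space))"
  by standard (auto simp: knorm_diff_commute intro: knorm_triangle_diff)

lemma closedin_krein_topologyI:
  fixes S :: "'a::krein_space set"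
  assumes "\<And>X l. (\<And>n. X n \<in> S) \<Longrightarrow> kconv X l \<Longrightarrow> l \<in> S"
  shows "closedin krein_topology S"
proof -
  interpret Metric_space UNIV "\<lambda>x y. knorm (x - y :: 'a)"
    by (rule Metric_space_knorm)
  have "\<exists>r>0. disjnt S (mball x r)" if "x \<notin> S" for x
  proof (rule ccontr)
    assume neg: "\<not> (\<exists>r>0. disjnt S (mball x r))"
    have "\<exists>y. y \<in> S \<and> knorm (y - x) < 1 / real (Suc n)" for n
    proof -
      have "\<not> disjnt S (mball x (1 / real (Suc n)))"
        using neg by auto
      then show ?thesis
        by (auto simp: disjnt_iff knorm_diff_commute)
    qed
    then obtain X where X: "\<And>n. X n \<in> S" "\<And>n. knorm (X n - x) < 1 / real (Suc n)"
      by metis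
    have "kconv X x"
    proof (rule kconv_le)
      show "knorm (X n - x) \<le> 1 / real (Suc n)" for n
        by (rule less_imp_le[OF X(2)])
      show "(\<lambda>n. 1 / real (Suc n)) \<longlonglongrightarrow> 0"
        by (rule LIMSEQ_Suc[OF lim_1_over_n])
    qed
    then show False using assms X(1) that by blast
  qed
  then show ?thesis
    unfolding krein_topology_def closedin_metric by auto
qed

text \<open>Writing the subspace as the kernel of a bounded operator makes it closed. The constant
  \<open>c\<close> and the bound of \<open>J\<close> make \<open>jnorm J\<close> equivalent to
  \<open>knorm\<close> there, so completeness is inherited.\<close>

lemma regular_kernel:
  fixes Q J :: "'a::krein_space \<Rightarrow> 'a"
  assumes Q: "bounded_operator Q" and J: "bounded_operator J"
    and QJ: "\<And>x. Q x = 0 \<Longrightarrow> Q (J x) = 0"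
    and JJ: "\<And>x. Q x = 0 \<Longrightarrow> J (J x) = x"
    and sym: "\<And>x y. Q x = 0 \<Longrightarrow> Q y = 0 \<Longrightarrow> kform (J x) y = kform x (J y)"
    and c: "c > 0" "\<And>x. Q x = 0 \<Longrightarrow> c * (knorm x)\<^sup>2 \<le> Re (kform (J x) x)"
  shows "regular_subspace {x. Q x = 0}"
proof -
  define S where "S = {x. Q x = 0}"
  note Q_simps = clinear_simps[OF bounded_operator_clinear[OF Q]]
  note J_simps = clinear_simps[OF bounded_operator_clinear[OF J]]
  have sub: "module.subspace scaleC S"
    unfolding complex_vector.subspace_def S_def by (simp add: Q_simps)
  have closed_seq: "l \<in> S" if "\<And>n. X n \<in> S" "kconv X l" for X l
  proof -
    have "kconv (\<lambda>n. Q (X n)) (Q l)"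
      by (rule kconv_bounded_operator[OF Q that(2)])
    then have "kconv (\<lambda>n. 0) (Q l)"
      using that(1) by (simp add: S_def)
    then have "0 = Q l" by (rule kconv_unique[OF kconv_const])
    then show ?thesis by (simp add: S_def)
  qed
  have diff: "x - y \<in> S" if "x \<in> S" "y \<in> S" for x y
    using that by (simp add: S_def Q_simps)
  have lower: "sqrt c * knorm x \<le> jnorm J x" if "x \<in> S" for x
  proof -
    have "sqrt (c * (knorm x)\<^sup>2) \<le> sqrt (Re (kform (J x) x))"
      using c(2)[of x] that by (intro real_sqrt_le_mono) (simp add: S_def)
    then show ?thesis by (simp add: jnorm_def real_sqrt_mult)
  qed
  obtain C where C: "C \<ge> 0" "\<And>x. knorm (J x) \<le> C * knorm x"
    using bounded_operator_bound[OF J] by blast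
  have upper: "jnorm J x \<le> sqrt C * knorm x" for x
  proof -
    have "Re (kform (J x) x) \<le> knorm (J x) * knorm x"
      using complex_Re_le_cmod kform_bound by (rule order_trans)
    also have "\<dots> \<le> C * knorm x * knorm x"
      by (rule mult_right_mono[OF C(2)]) simp
    finally have "Re (kform (J x) x) \<le> C * (knorm x)\<^sup>2"
      by (simp add: power2_eq_square mult.assoc)
    then have "sqrt (Re (kform (J x) x)) \<le> sqrt (C * (knorm x)\<^sup>2)"
      by (rule real_sqrt_le_mono)
    then show ?thesis by (simp add: jnorm_def real_sqrt_mult)
  qed
  have "fundamental_symmetry_on S J"
    unfolding fundamental_symmetry_on_def
  proof (intro conjI ballI allI impI)
    fix x assume x: "x \<in> S"
    then show "J x \<in> S" "J (J x) = x"
      using QJ JJ by (auto simp: S_def)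
    assume "x \<noteq> 0"
    have "kform (J x) x = cnj (kform (J x) x)"
      using sym[of x x] x kform_hermitian[of x "J x"] by (simp add: S_def)
    then show "kform (J x) x \<in> \<real>"
      by (simp add: Reals_cnj_iff)
    have "0 < c * (knorm x)\<^sup>2"
      using c(1) \<open>x \<noteq> 0\<close> by (intro mult_pos_pos zero_less_power) (simp_all add: less_le)
    then show "0 < Re (kform (J x) x)"
      using c(2)[of x] x by (simp add: S_def)
  next
    fix x y assume "x \<in> S" "y \<in> S"
    then show "kform (J y) x = cnj (kform (J x) y)"
      using sym[of x y] kform_hermitian[of "J y" x] by (simp add: S_def)
  next
    fix X :: "nat \<Rightarrow> 'a"
    assume X: "range X \<subseteq> S \<and> (\<forall>e>0. \<exists>M. \<forall>m\<ge>M. \<forall>n\<ge>M. jnorm J (X m - X n) < e)"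
    have "\<exists>l. kconv X l"
    proof (rule kconv_complete)
      fix e :: real assume "e > 0"
      then have "sqrt c * e > 0" using c(1) by simp
      from X[THEN conjunct2, rule_format, OF this]
      obtain M where M: "\<forall>m\<ge>M. \<forall>n\<ge>M. jnorm J (X m - X n) < sqrt c * e" ..
      have "knorm (X m - X n) < e" if "m \<ge> M" "n \<ge> M" for m n
      proof -
        have "X m - X n \<in> S" using X by (intro diff) auto
        from order_le_less_trans[OF lower[OF this] M[rule_format, OF that]]
        have "sqrt c * knorm (X m - X n) < sqrt c * e" .
        then show ?thesis using c(1) by simp
      qed
      then show "\<exists>M. \<forall>m\<ge>M. \<forall>n\<ge>M. knorm (X m - X n) < e" by blast
    qed
    then obtain l where l: "kconv X l" ..
    have "l \<in> S" using X l by (intro closed_seq[of X l]) auto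
    moreover have "(\<lambda>n. jnorm J (X n - l)) \<longlonglongrightarrow> 0"
    proof (rule tendsto_sandwich[OF _ _ tendsto_const])
      show "(\<lambda>n. sqrt C * knorm (X n - l)) \<longlonglongrightarrow> 0"
        using tendsto_mult[OF tendsto_const l[unfolded kconv_def], of "sqrt C"] by simp
      have "jnorm J (X n - l) \<ge> 0" for n
      proof -
        have "X n - l \<in> S" using X \<open>l \<in> S\<close> by (intro diff) auto
        then have "sqrt c * knorm (X n - l) \<le> jnorm J (X n - l)"
          by (rule lower)
        moreover have "0 \<le> sqrt c * knorm (X n - l)" using c(1) by simp
        ultimately show ?thesis by (rule order_trans[rotated])
      qed
      then show "\<forall>\<^sub>F n in sequentially. 0 \<le> jnorm J (X n - l)" by simp
      show "\<forall>\<^sub>F n in sequentially. jnorm J (X n - l) \<le> sqrt C * knorm (X n - l)"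
        using upper by simp
    qed
    ultimately show "\<exists>x\<in>S. (\<lambda>n. jnorm J (X n - x)) \<longlonglongrightarrow> 0" by blast
  qed (simp_all add: J_simps)
  moreover have "closedin krein_topology S"
    using closed_seq by (rule closedin_krein_topologyI)
  ultimately show ?thesis
    using sub unfolding regular_subspace_def S_def by blast
qed

text \<open>The sign \<open>Y \<bar>Y\<bar>^{-1}\<close> of the Gram operator \<open>Y = E J E\<close> is a fundamental symmetry of the
  range of \<open>E\<close>; it is obtained as the value at \<open>t = Y^2\<close> of the function \<open>Y t^{-1/2}\<close>.\<close>

lemma regular_projection_range:
  fixes E :: "'a::krein_space \<Rightarrow> 'a"
  assumes bE: "bounded_operator E" and sE: "kselfadjoint E" and EE: "\<And>x. E (E x) = E x"
  shows "regular_subspace {x. E x = x}"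
proof -
  define Y where "Y = (\<lambda>x. E (fsym (E x)))"
  define T where "T = (\<lambda>x. Y (Y x))"
  have E_sym: "kform (E x) y = kform x (E y)" for x y
    using sE by (simp add: kselfadjoint_def is_kadjoint_def)
  have bY: "bounded_operator Y"
    unfolding Y_def
    by (rule bounded_operator_compose[OF bE bounded_operator_compose[OF bounded_operator_fsym bE]])
  have bT: "bounded_operator T"
    unfolding T_def by (rule bounded_operator_compose[OF bY bY])
  note E_simps = clinear_simps[OF bounded_operator_clinear[OF bE]]
  note Y_simps = clinear_simps[OF bounded_operator_clinear[OF bY]]
  have EY: "E (Y x) = Y x" and YE: "Y (E x) = Y x" for x
    by (simp_all add: Y_def EE)
  have Y_form: "kform (Y x) y = kform (fsym (E x)) (E y)" for x y
    by (simp add: Y_def E_sym)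
  have pY: "kpositive Y"
    using kpositive_fsym[where 'a = 'a] unfolding kpositive_iff Y_form by blast
  have Y_sym: "kform (Y x) y = kform x (Y y)" for x y
    by (rule kpositive_selfadjoint[OF bounded_operator_clinear[OF bY] pY])
  have sT: "kselfadjoint T"
    by (simp add: kselfadjoint_def is_kadjoint_def T_def Y_sym)
  have Y_energy: "Re (kform (Y x) x) = (knorm (E x))\<^sup>2" for x
    by (simp add: Y_form knorm_sq)
  have YT_energy: "Re (kform (Y (T x)) x) = (knorm (Y x))\<^sup>2" for x
  proof -
    have "kform (Y (T x)) x = kform (Y (Y x)) (Y x)"
      by (simp add: T_def Y_sym)
    then show ?thesis by (simp add: Y_energy EY)
  qed
  \<comment> \<open>\<open>(knorm (E x))\<^sup>2\<close> is the real part of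
    \<open>[Y x, E x]\<close>; dividing by \<open>knorm (E x)\<close> shows that \<open>Y\<close> is
    bounded below on the range of \<open>E\<close>.\<close>
  have E_le_Y: "knorm (E x) \<le> knorm (Y x)" for x
  proof (cases "knorm (E x) = 0")
    case False
    have "(knorm (E x))\<^sup>2 = Re (kform (Y x) (E x))"
      by (simp add: Y_form EE knorm_sq)
    also have "\<dots> \<le> knorm (Y x) * knorm (E x)"
      using complex_Re_le_cmod kform_bound by (rule order_trans)
    finally have "knorm (E x) * knorm (E x) \<le> knorm (Y x) * knorm (E x)"
      by (simp add: power2_eq_square)
    then show ?thesis
      by (rule mult_right_le_imp_le) (use False knorm_nonneg[of "E x"] in linarith)
  qed simp
  have YT: "Y (T x) = T (Y x)" for x by (simp add: T_def)
  obtain r where r: "r > 0" "\<And>x. \<bar>Re (kform (Y (T x)) x)\<bar> \<le> r * Re (kform (Y x) x)"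
    using selfadjoint_relative_bound[OF bY pY bT sT YT] by blast
  \<comment> \<open>The lower endpoint 1 is the estimate \<open>E_le_Y\<close>; it keeps the square
    root away from zero. Taking \<open>r + 2\<close> instead of \<open>r\<close> puts the upper
    endpoint above 1.\<close>
  interpret positive_pair Y T 1 "r + 2"
  proof
    fix x
    show "1 * Re (kform (Y x) x) \<le> Re (kform (Y (T x)) x)"
      unfolding YT_energy Y_energy using power_mono[OF E_le_Y knorm_nonneg, of x 2] by simp
    have "Re (kform (Y (T x)) x) \<le> r * Re (kform (Y x) x)"
      using r(2)[of x] by simp
    also have "\<dots> \<le> (r + 2) * Re (kform (Y x) x)"
      unfolding Y_energy by (intro mult_right_mono) simp_all
    finally show "Re (kform (Y (T x)) x) \<le> (r + 2) * Re (kform (Y x) x)" .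
  qed (use r(1) bY bT pY sT YT in simp_all)
  define f :: "real \<Rightarrow> real" where "f t = 1 / sqrt t" for t
  have f: "continuous_on {1..r + 2} f"
    unfolding f_def by (intro continuous_intros) auto
  \<comment> \<open>The minimum of \<open>f\<close> on the interval; on the range of
    \<open>E\<close> the form of \<open>Y\<close> is the squared norm, so this is the definiteness
    constant.\<close>
  define c where "c = 1 / sqrt (r + 2)"
  have c: "c > 0" using r(1) by (simp add: c_def)
  have E_fc: "E (fc f x) = fc f (E x)" for x
    by (rule fc_commute[OF f bE]) (simp_all add: EY YE T_def)
  have E_inv: "E (fc f x) = fc f x" if "E x = x" for x
    using E_fc[of x] that by simp
  have "regular_subspace {x. x - E x = 0}"
  proof (rule regular_kernel)
    show "bounded_operator (\<lambda>x. x - E x)"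
      by (rule bounded_operator_diff[OF bounded_operator_ident bE])
    show "bounded_operator (fc f)" by (rule bounded_operator_fc[OF f])
    show "c > 0" by (rule c)
    show "fc f x - E (fc f x) = 0" if "x - E x = 0" for x
      using E_inv[of x] that by simp
    show "kform (fc f x) y = kform x (fc f y)" for x y
      by (rule fc_adjoint[OF f])
    show "fc f (fc f x) = x" if "x - E x = 0" for x
    proof -
      have x: "E x = x" using that by simp
      \<comment> \<open>Multiplying by \<open>Y = H\<close> produces
        \<open>t * f t * f t = 1\<close>, hence \<open>Y x\<close>; then \<open>Y\<close> is
        cancelled by means of \<open>E_le_Y\<close>.\<close>
      have "Y (fc f (fc f x)) = T (fc (\<lambda>t. f t * f t) x)"
        unfolding fc_fc[OF f f] by (simp add: T_def)
      also have "\<dots> = rop [:0, 1:] T (fc (\<lambda>t. f t * f t) x)"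
        unfolding rop_linear[OF lT] by (simp add: scaleC_one)
      also have "\<dots> = fc (\<lambda>t. poly [:0, 1:] t * (f t * f t)) x"
        by (rule fc_poly_mult[symmetric, OF continuous_on_mult[OF f f]])
      also have "\<dots> = fc (\<lambda>t. 1) x"
        by (rule fc_cong) (auto simp: f_def)
      finally have "Y (fc f (fc f x) - x) = 0"
        by (simp add: fc_one Y_simps)
      then have "knorm (E (fc f (fc f x) - x)) \<le> 0"
        using E_le_Y[of "fc f (fc f x) - x"] by simp
      then have "knorm (E (fc f (fc f x) - x)) = 0"
        by (rule order_antisym) simp
      then have "E (fc f (fc f x)) - E x = 0"
        by (simp add: E_simps)
      then show ?thesis
        unfolding E_inv[OF E_inv[OF x]] x by simp
    qed
    show "c * (knorm x)\<^sup>2 \<le> Re (kform (fc f x) x)" if "x - E x = 0" for x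
    proof -
      have "c * (knorm x)\<^sup>2 = Re (kform (fc (\<lambda>t. c * 1) x) x)"
        unfolding fc_scale[OF continuous_on_const] fc_one kform_scale_left
        using Y_energy[of x] that by simp
      also have "\<dots> \<le> Re (kform (fc f x) x)"
      proof (rule fc_mono[OF _ f])
        fix t assume "t \<in> {1..r + 2}"
        then have "0 < sqrt t" "sqrt t \<le> sqrt (r + 2)" by simp_all
        then show "c * 1 \<le> f t"
          unfolding c_def f_def mult_1_right by (intro divide_left_mono mult_pos_pos) simp_all
      qed (intro continuous_intros)
      finally show ?thesis .
    qed
  qed
  moreover have "{x. x - E x = 0} = {x. E x = x}" by auto
  ultimately show ?thesis by simp
qed

section \<open>Operators commuting with a regularly irreducible group\<close>

text \<open>A vanishing quadratic form is in particular positive, so Cauchy-Schwarz makes the whole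
  sesquilinear form vanish.\<close>

lemma kform_eq_zero_of_kpositive:
  assumes "clinear B" "kselfadjoint B" "\<And>x. Re (kform (B x) x) = 0"
  shows "B x = 0"
proof (rule kform_nondegenerate)
  fix y
  have "Im (kform (B x) x) = 0" for x
  proof -
    have "kform (B x) x = cnj (kform (B x) x)"
      using assms(2) kform_hermitian[of x "B x"] by (simp add: kselfadjoint_def is_kadjoint_def)
    from arg_cong[OF this, of Im] show ?thesis by simp
  qed
  then have "kpositive B"
    unfolding kpositive_iff assms(3) by simp
  from kpositive_cauchy_schwarz[OF assms(1) this, of x y]
  show "kform (B x) y = 0"
    unfolding assms(3) by simp
qed

lemma zero_of_small_multiples:
  fixes y n :: real
  assumes "\<And>e. e > 0 \<Longrightarrow> y \<le> e * n"
  shows "y \<le> 0"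
proof (rule field_le_epsilon)
  fix e :: real assume e: "e > 0"
  define d where "d = e / (\<bar>n\<bar> + 1)"
  have d: "d > 0" unfolding d_def by (rule divide_pos_pos) (use e in simp_all)
  have "d * (\<bar>n\<bar> + 1) = e" by (simp add: d_def)
  then have "d * \<bar>n\<bar> \<le> e" using d by (simp add: distrib_left)
  moreover have "d * n \<le> d * \<bar>n\<bar>" by (rule mult_left_mono) (use d in simp_all)
  ultimately show "y \<le> 0 + e" using assms[OF d] by linarith
qed

locale irreducible_commutant =
  fixes G :: "('a::krein_space \<Rightarrow> 'a) set" and A :: "'a \<Rightarrow> 'a"
  assumes bG: "T \<in> G \<Longrightarrow> bounded_operator T"
    and irreducible: "regularly_irreducible G"
    and bA: "bounded_operator A" and sA: "kselfadjoint A"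
    and GA: "T \<in> G \<Longrightarrow> T (A x) = A (T x)"
begin

lemmas lA = bounded_operator_clinear[OF bA]
lemmas A_simps = clinear_simps[OF lA]

lemma G_rop: "T \<in> G \<Longrightarrow> T (rop f A x) = rop f A (T x)"
  by (rule rop_commute[OF lA bounded_operator_clinear[OF bG] GA])

text \<open>Schur's lemma in the form available here: the kernel of a map commuting with
  \<open>G\<close> is invariant, but irreducibility applies only once that kernel is known to be
  regular.\<close>

lemma kernel_dichotomy:
  assumes "\<And>T x. T \<in> G \<Longrightarrow> T (Q x) = Q (T x)" "regular_subspace {x. Q x = 0}"
  shows "(\<forall>x. Q x = 0) \<or> (\<forall>x. Q x = 0 \<longrightarrow> x = 0)"
proof -
  have "invariant_subspace G {x. Q x = 0}"
    unfolding invariant_subspace_def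
  proof (intro conjI ballI subsetI)
    show "module.subspace scaleC {x. Q x = 0}"
      using assms(2) unfolding regular_subspace_def by blast
    fix T y assume T: "T \<in> G" and "y \<in> T ` {x. Q x = 0}"
    then obtain x where x: "Q x = 0" "y = T x" by blast
    have "Q (T x) = T 0"
      using assms(1)[OF T, of x] x(1) by simp
    then show "y \<in> {x. Q x = 0}"
      by (simp add: x(2) clinear_simps(3)[OF bounded_operator_clinear[OF bG[OF T]]])
  qed
  then have "{x. Q x = 0} = {0} \<or> {x. Q x = 0} = UNIV"
    using irreducible assms(2) unfolding regularly_irreducible_def by blast
  then show ?thesis by blast
qed

text \<open>Meant for \<open>s = 1\<close> and \<open>s = - 1\<close>: up to this sign, the form is
  then a Hilbert inner product on the whole space, with norm equivalent to
  \<open>knorm\<close>.\<close>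

definition definite :: "real \<Rightarrow> bool" where
  "definite s \<longleftrightarrow> (\<exists>c>0. \<forall>x::'a. c * (knorm x)\<^sup>2 \<le> s * Re (kform x x))"

text \<open>On a uniformly definite kernel, \<open>s\<close> times the identity is a fundamental
  symmetry.\<close>

lemma definite_kernel_dichotomy:
  assumes Q: "bounded_operator Q" and QG: "\<And>T x. T \<in> G \<Longrightarrow> T (Q x) = Q (T x)"
    and s: "s\<^sup>2 = 1"
    and c: "c > 0" "\<And>x. Q x = 0 \<Longrightarrow> c * (knorm x)\<^sup>2 \<le> s * Re (kform x x)"
  shows "(\<forall>x. Q x = 0) \<or> (\<forall>x. Q x = 0 \<longrightarrow> x = 0)"
proof (rule kernel_dichotomy[OF QG])
  have ss: "of_real s * of_real s = (1::complex)"
    using s by (simp add: power2_eq_square flip: of_real_mult)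
  show "regular_subspace {x. Q x = 0}"
  proof (rule regular_kernel[OF Q])
    show "bounded_operator (\<lambda>x::'a. of_real s *\<^sub>C x)"
      by (rule bounded_operator_scale[OF bounded_operator_ident])
    show "c > 0" by (rule c(1))
    show "Q (of_real s *\<^sub>C x) = 0" if "Q x = 0" for x
      using that by (simp add: clinear_simps[OF bounded_operator_clinear[OF Q]])
    show "of_real s *\<^sub>C of_real s *\<^sub>C x = x" for x :: 'a
      by (simp add: scaleC_scaleC ss scaleC_one)
    show "kform (of_real s *\<^sub>C x) y = kform x (of_real s *\<^sub>C y)" for x y :: 'a
      by (simp add: kform_simps)
    show "c * (knorm x)\<^sup>2 \<le> Re (kform (of_real s *\<^sub>C x) x)" if "Q x = 0" for x
      using c(2)[OF that] by (simp add: kform_simps)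
  qed
qed

text \<open>With \<open>g = s / max (s p) e\<close>, the subspace \<open>g(A) p(A) x = x\<close> is uniformly definite and
  contains the range of \<open>p(A) (s p - e)^+(A)\<close>.\<close>

lemma definite_or_fc_part_zero:
  assumes pp: "positive_pair (rop p A) A a b" and s: "s = 1 \<or> s = - 1" and "\<not> definite s" and e: "e > 0"
  shows "positive_pair.fc (rop p A) A a b (\<lambda>t. max (s * poly p t - e) 0) x = 0"
proof -
  interpret positive_pair "rop p A" A a b by (rule pp)
  have s2: "s\<^sup>2 = 1" "s * s = 1" using s by auto
  define m where "m t = max (s * poly p t) e" for t
  have m: "m t \<ge> e" "m t > 0" for t using e by (auto simp: m_def)
  define g where "g t = s * (1 / m t)" for t
  define u where "u t = max (s * poly p t - e) 0" for t
  have cm: "continuous_on {a..b} (\<lambda>t. 1 / m t)"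
  proof (intro continuous_on_divide continuous_on_const ballI)
    show "continuous_on {a..b} m" unfolding m_def by (intro continuous_intros)
    show "m t \<noteq> 0" for t using m(2)[of t] by simp
  qed
  have cg: "continuous_on {a..b} g" unfolding g_def
    by (intro continuous_on_mult continuous_on_const cm)
  have cu: "continuous_on {a..b} u" unfolding u_def by (intro continuous_intros)
  define Q where "Q x = x - fc g x" for x
  have bQ: "bounded_operator Q" unfolding Q_def
    by (rule bounded_operator_diff[OF bounded_operator_ident bounded_operator_fc[OF cg]])
  have QG: "T (Q x) = Q (T x)" if "T \<in> G" for T x
  proof -
    have "T (fc g x) = fc g (T x)"
      by (rule fc_commute[OF cg bG[OF that] G_rop[OF that] GA[OF that]])
    then show ?thesis
      by (simp add: Q_def clinear_simps[OF bounded_operator_clinear[OF bG[OF that]]])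
  qed
  define c where "c = e / (hconst + 1)"
  have c: "c > 0" using e hconst(1) by (simp add: c_def add_nonneg_pos)
  have pos: "c * (knorm x)\<^sup>2 \<le> s * Re (kform x x)" if "Q x = 0" for x
  proof -
    have x: "fc g x = x" using that by (simp add: Q_def)
    have "s * Re (kform x x) = Re (kform (fc (\<lambda>t. s * g t) x) x)"
      unfolding fc_scale[OF cg] kform_scale_left x by simp
    also have "fc (\<lambda>t. s * g t) x = fc (\<lambda>t. 1 / m t) x"
      by (rule fc_cong) (simp add: g_def mult.assoc[symmetric] s2)
    finally have sx: "s * Re (kform x x) = Re (kform (fc (\<lambda>t. 1 / m t) x) x)" .
    have nonneg: "s * Re (kform x x) \<ge> 0"
      unfolding sx by (rule fc_nonneg[OF cm]) (use m(2) in \<open>simp add: less_imp_le\<close>)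
    \<comment> \<open>From \<open>m t \<ge> e\<close> follows
      \<open>e * (g t)\<^sup>2 = e / (m t)\<^sup>2 \<le> 1 / m t\<close>. This bounds the squared
      norm of \<open>x = fc g x\<close> by a multiple of \<open>s * Re (kform x x)\<close>.\<close>
    have "e * Re (kform (fc (\<lambda>t. g t * g t) x) x) = Re (kform (fc (\<lambda>t. e * (g t * g t)) x) x)"
      unfolding fc_scale[OF continuous_on_mult[OF cg cg]] kform_scale_left by simp
    also have "\<dots> \<le> Re (kform (fc (\<lambda>t. 1 / m t) x) x)"
    proof (rule fc_mono[OF _ cm])
      show "continuous_on {a..b} (\<lambda>t. e * (g t * g t))"
        by (intro continuous_on_mult continuous_on_const cg)
      fix t
      have "g t * g t = (s * s) * (1 / m t * (1 / m t))"
        by (simp add: g_def)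
      then have "e * (g t * g t) = e / m t * (1 / m t)"
        by (simp add: s2)
      also have "\<dots> \<le> 1 * (1 / m t)"
        using m[of t] e by (intro mult_right_mono) (simp_all add: less_imp_le)
      finally show "e * (g t * g t) \<le> 1 / m t" by simp
    qed
    finally have le: "e * Re (kform (fc (\<lambda>t. g t * g t) x) x) \<le> s * Re (kform x x)"
      unfolding sx .
    have "e * (knorm x)\<^sup>2 \<le> e * (hconst * Re (kform (fc (\<lambda>t. g t * g t) x) x))"
      using fc_norm_sq[OF cg, of x] e unfolding x by (intro mult_left_mono) simp_all
    also have "\<dots> = hconst * (e * Re (kform (fc (\<lambda>t. g t * g t) x) x))"
      by simp
    also have "\<dots> \<le> hconst * (s * Re (kform x x))"
      by (rule mult_left_mono[OF le hconst(1)])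
    also have "\<dots> \<le> (hconst + 1) * (s * Re (kform x x))"
      using nonneg by (intro mult_right_mono) simp_all
    finally have "e * (knorm x)\<^sup>2 \<le> (hconst + 1) * (s * Re (kform x x))" .
    then show ?thesis
      using hconst(1) by (simp add: c_def field_simps add_nonneg_pos)
  qed
  \<comment> \<open>If \<open>Q\<close> vanished identically, \<open>pos\<close> would hold on the
    whole space and make the form definite.\<close>
  have "\<not> (\<forall>x. Q x = 0)"
    using pos c \<open>\<not> definite s\<close> unfolding definite_def by blast
  then have inj: "\<forall>x. Q x = 0 \<longrightarrow> x = 0"
    using definite_kernel_dichotomy[OF bQ QG s2(1) c pos] by blast
  have "fc g (fc u x) = rop p A (fc (\<lambda>t. g t * u t) x)"
    by (rule fc_fc[OF cg cu])
  also have "\<dots> = fc (\<lambda>t. poly p t * (g t * u t)) x"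
    by (rule fc_poly_mult[symmetric, OF continuous_on_mult[OF cg cu]])
  also have "\<dots> = fc u x"
  proof (rule fc_cong)
    fix t
    show "poly p t * (g t * u t) = u t"
    \<comment> \<open>Where \<open>u\<close> is nonzero, \<open>m t = s * poly p t\<close> and thus
      \<open>poly p t * g t = 1\<close>.\<close>
    proof (cases "s * poly p t > e")
      case True
      then have "m t = s * poly p t" by (simp add: m_def)
      moreover have "s * poly p t \<noteq> 0" using True e by linarith
      ultimately show ?thesis by (simp add: g_def)
    next
      case False
      then show ?thesis by (simp add: u_def)
    qed
  qed
  finally have "Q (fc u x) = 0" by (simp add: Q_def)
  then show ?thesis using inj unfolding u_def by blast
qed

text \<open>The positive and negative parts \<open>u\<close> and \<open>v\<close> of
  \<open>p\<close>, each cut off at height \<open>e\<close>, are killed by the preceding lemma.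
  Since \<open>u - v\<close> is within \<open>e\<close> of \<open>p\<close>, the vector
  \<open>fc (poly p) x\<close>, which is \<open>p(A)\<close> applied twice, has norm at most
  \<open>e * hnorm x\<close> for every \<open>e\<close>.\<close>

lemma rop_square_zero:
  assumes pos: "kpositive (rop p A)" and nd: "\<not> definite 1" "\<not> definite (- 1)"
  shows "rop p A (rop p A x) = 0"
proof -
  have comm: "rop p A (A x) = A (rop p A x)" for x
    by (rule rop_commute[OF lA lA, symmetric]) simp
  have bp: "bounded_operator (rop p A)"
    by (rule bounded_operator_poly_op[OF bA])
  obtain r where r: "r > 0" "\<And>x. \<bar>Re (kform (rop p A (A x)) x)\<bar> \<le> r * Re (kform (rop p A x) x)"
    using selfadjoint_relative_bound[OF bp pos bA sA comm] by blast
  have pp: "positive_pair (rop p A) A (- r) r"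
  proof
    fix x
    show "- r * Re (kform (rop p A x) x) \<le> Re (kform (rop p A (A x)) x)"
      "Re (kform (rop p A (A x)) x) \<le> r * Re (kform (rop p A x) x)"
      using r(2)[of x] by (simp_all add: abs_le_iff)
  qed (use r(1) bp bA pos sA comm in simp_all)
  interpret positive_pair "rop p A" A "- r" r by (rule pp)
  have "knorm (fc (poly p) x) \<le> e * hnorm x" if e: "e > 0" for e
  proof -
    define u where "u t = max (1 * poly p t - e) 0" for t
    define v where "v t = max (- 1 * poly p t - e) 0" for t
    have cont: "continuous_on {- r..r} u" "continuous_on {- r..r} v"
      unfolding u_def v_def by (intro continuous_intros)+
    have cp: "continuous_on {- r..r} (poly p)" by (intro continuous_intros)
    have "fc u x = 0"
      unfolding u_def by (rule definite_or_fc_part_zero[OF pp _ nd(1) e]) simp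
    moreover have "fc v x = 0"
      unfolding v_def by (rule definite_or_fc_part_zero[OF pp _ nd(2) e]) simp
    ultimately have "fc (poly p) x = fc (\<lambda>t. poly p t - (u t - v t)) x"
      unfolding fc_diff[OF cp continuous_on_diff[OF cont]] fc_diff[OF cont] by simp
    also have "knorm \<dots> \<le> e * hnorm x"
      by (rule fc_norm_le[OF continuous_on_diff[OF cp continuous_on_diff[OF cont]]])
        (use e in \<open>auto simp: u_def v_def\<close>)
    finally show ?thesis .
  qed
  then have "knorm (fc (poly p) x) \<le> 0"
    by (rule zero_of_small_multiples)
  then have "knorm (fc (poly p) x) = 0"
    by (rule order_antisym) simp
  then show ?thesis unfolding fc_poly by simp
qed

text \<open>For each real \<open>l\<close> the parts \<open>(A - l)^+\<close> and
  \<open>(A - l)^-\<close> have product zero. By the dichotomy the first is zero or injective, and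
  in the second case the other part is zero. So \<open>A\<close> lies below or above every real
  \<open>l\<close>, which confines its numerical range to one point.\<close>

lemma scalar_of_definite:
  assumes "definite s" and s: "s = 1 \<or> s = - 1"
  shows "\<exists>l::real. \<forall>x. A x = of_real l *\<^sub>C x"
proof (cases "\<exists>x::'a. x \<noteq> 0")
  case False
  then show ?thesis by metis
next
  case True
  then obtain x0 :: 'a where x0: "x0 \<noteq> 0" ..
  obtain c where c: "c > 0" "\<And>x::'a. c * (knorm x)\<^sup>2 \<le> s * Re (kform x x)"
    using assms(1) unfolding definite_def by blast
  have s2: "s\<^sup>2 = 1" using s by auto
  define H where "H x = of_real s *\<^sub>C x" for x :: 'a
  have bH: "bounded_operator H"
    unfolding H_def by (rule bounded_operator_scale[OF bounded_operator_ident])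
  define N where "N x = Re (kform (H x) x)" for x
  have N: "N x = s * Re (kform x x)" for x by (simp add: N_def H_def kform_simps)
  have N_nonneg: "N x \<ge> 0" for x
  proof -
    have "0 \<le> c * (knorm x)\<^sup>2" using c(1) by simp
    then show ?thesis using c(2)[of x] unfolding N by (rule order_trans)
  qed
  have pH: "kpositive H"
    unfolding kpositive_iff
  proof (intro allI conjI)
    fix x
    show "Im (kform (H x) x) = 0" by (simp add: H_def kform_simps kform_self_real)
    show "0 \<le> Re (kform (H x) x)" using N_nonneg[of x] by (simp add: N_def)
  qed
  have comm: "H (A x) = A (H x)" for x by (simp add: H_def A_simps)
  obtain r where r: "r > 0" "\<And>x. \<bar>Re (kform (H (A x)) x)\<bar> \<le> r * Re (kform (H x) x)"
    using selfadjoint_relative_bound[OF bH pH bA sA comm] by blast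
  interpret positive_pair H A "- r" r
  proof
    fix x
    show "- r * Re (kform (H x) x) \<le> Re (kform (H (A x)) x)"
      "Re (kform (H (A x)) x) \<le> r * Re (kform (H x) x)"
      using r(2)[of x] by (simp_all add: abs_le_iff)
  qed (use r(1) bH bA pH sA comm in simp_all)
  define F where "F x = Re (kform (H (A x)) x)" for x
  have alt: "(\<forall>x. F x \<le> l * N x) \<or> (\<forall>x. l * N x \<le> F x)" for l
  proof -
    define u where "u t = max (t - l) 0" for t
    define v where "v t = max (l - t) 0" for t
    have cont: "continuous_on {- r..r} u" "continuous_on {- r..r} v"
      unfolding u_def v_def by (intro continuous_intros)+
    have diff: "F x - l * N x = Re (kform (fc u x) x) - Re (kform (fc v x) x)" for x
    proof -
      have "fc u x - fc v x = fc (\<lambda>t. u t - v t) x"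
        by (rule fc_diff[OF cont, symmetric])
      also have "\<dots> = fc (poly [:- l, 1:]) x"
        by (rule fc_cong) (auto simp: u_def v_def)
      also have "\<dots> = H (A x) - of_real l *\<^sub>C H x"
        unfolding fc_poly rop_linear[OF lA] by (simp add: H_simps scaleC_one)
      finally have eq: "fc u x - fc v x = H (A x) - of_real l *\<^sub>C H x" .
      have "Re (kform (fc u x - fc v x) x) = F x - l * N x"
        unfolding eq by (simp add: kform_simps F_def N_def)
      then show ?thesis by (simp add: kform_simps)
    qed
    have uG: "T (fc u x) = fc u (T x)" if T: "T \<in> G" for T x
    proof (rule fc_commute[OF cont(1) bG[OF T] _ GA[OF T]])
      show "T (H x) = H (T x)" for x
        by (simp add: H_def clinear_simps[OF bounded_operator_clinear[OF bG[OF T]]])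
    qed
    have "(\<forall>x. fc u x = 0) \<or> (\<forall>x. fc u x = 0 \<longrightarrow> x = 0)"
      using uG by (rule definite_kernel_dichotomy[OF bounded_operator_fc[OF cont(1)] _ s2 c])
    then show ?thesis
    proof
      assume u0: "\<forall>x. fc u x = 0"
      have "F x \<le> l * N x" for x
        using diff[of x] u0 fc_nonneg[OF cont(2), of x] by (simp add: v_def)
      then show ?thesis by blast
    next
      assume inj: "\<forall>x. fc u x = 0 \<longrightarrow> x = 0"
      have "fc v x = 0" for x
      proof -
        have "fc u (fc v x) = H (fc (\<lambda>t. u t * v t) x)"
          by (rule fc_fc[OF cont])
        also have "fc (\<lambda>t. u t * v t) x = fc (poly 0) x"
          by (rule fc_cong) (auto simp: u_def v_def max_def)
        finally have "fc u (fc v x) = 0"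
          unfolding fc_poly by (simp add: H_simps)
        then show ?thesis using inj by blast
      qed
      then have "l * N x \<le> F x" for x
        using diff[of x] fc_nonneg[OF cont(1), of x] by (simp add: u_def)
      then show ?thesis by blast
    qed
  qed
  have N_pos: "N x0 > 0"
  proof -
    have "0 < c * (knorm x0)\<^sup>2"
      using c(1) x0 by (intro mult_pos_pos zero_less_power) (simp_all add: less_le)
    then show ?thesis using c(2)[of x0] unfolding N by (rule order_less_le_trans)
  qed
  \<comment> \<open>The Rayleigh quotient at \<open>x0\<close>. At \<open>x0\<close> itself
    \<open>A\<close> is strictly below \<open>l + e\<close> and strictly above \<open>l - e\<close>,
    which selects the alternative valid for all vectors.\<close>
  define l where "l = F x0 / N x0"
  have l: "F x0 = l * N x0" using N_pos by (simp add: l_def)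
  have F: "F x = l * N x" for x
  proof (rule order_antisym)
    have "F x \<le> l * N x + e * N x" if "e > 0" for e
    proof -
      have "\<not> (l + e) * N x0 \<le> F x0"
        using mult_pos_pos[OF that N_pos] by (simp add: l distrib_right)
      then have "F x \<le> (l + e) * N x"
        using alt[of "l + e"] by blast
      then show ?thesis by (simp add: distrib_right)
    qed
    then have "F x - l * N x \<le> 0"
      by (intro zero_of_small_multiples[of _ "N x"]) (simp add: algebra_simps)
    then show "F x \<le> l * N x" by simp
    have "l * N x - e * N x \<le> F x" if "e > 0" for e
    proof -
      have "\<not> F x0 \<le> (l - e) * N x0"
        using mult_pos_pos[OF that N_pos] by (simp add: l left_diff_distrib)
      then have "(l - e) * N x \<le> F x"
        using alt[of "l - e"] by blast
      then show ?thesis by (simp add: left_diff_distrib)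
    qed
    then have "l * N x - F x \<le> 0"
      by (intro zero_of_small_multiples[of _ "N x"]) (simp add: algebra_simps)
    then show "l * N x \<le> F x" by simp
  qed
  define B where "B x = A x - of_real l *\<^sub>C x" for x
  have "B x = 0" for x
  proof (rule kform_eq_zero_of_kpositive[of B])
    show "clinear B" unfolding B_def
      by (rule bounded_operator_clinear[OF bounded_operator_diff[OF bA
              bounded_operator_scale[OF bounded_operator_ident]]])
    show "kselfadjoint B"
      using sA by (simp add: kselfadjoint_def is_kadjoint_def B_def kform_simps)
    show "Re (kform (B x) x) = 0" for x
    proof -
      have "s * Re (kform (B x) x) = F x - l * N x"
        by (simp add: B_def F_def N H_def kform_simps algebra_simps)
      then show ?thesis using F[of x] s by auto
    qed
  qed
  then have "A x = of_real l *\<^sub>C x" for x by (simp add: B_def)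
  then show ?thesis by blast
qed

end

section \<open>Real annihilating polynomials and nilpotency\<close>

lemma real_definitizing_polynomial:
  assumes "bounded_operator A" "definitizable A"
  shows "\<exists>q. q \<noteq> 0 \<and> kpositive (rop q A)"
proof -
  obtain p where p: "p \<noteq> 0" "kpositive (poly_op p A)" and sA: "kselfadjoint A"
    using assms(2) unfolding definitizable_def by blast
  note lA = bounded_operator_clinear[OF assms(1)]
  define p' where "p' = map_poly cnj p"
  have p'_op: "poly_op p' A y = poly_op p A y" for y
  proof -
    have "poly_op p A y - poly_op p' A y = 0"
    proof (rule kform_nondegenerate)
      fix x
      have "kform x (poly_op p A y) = kform x (poly_op p' A y)"
        using kpositive_selfadjoint[OF clinear_poly_op[OF lA] p(2), of x y]
          poly_op_adjoint[OF lA sA, of p x y] by (simp add: p'_def)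
      then have "kform x (poly_op p A y - poly_op p' A y) = 0"
        by (simp add: kform_diff_right)
      then show "kform (poly_op p A y - poly_op p' A y) x = 0"
        using kform_hermitian[of "poly_op p A y - poly_op p' A y" x] by simp
    qed
    then show ?thesis by simp
  qed
  define f where "f = map_poly Re p"
  define g where "g = map_poly Im p"
  have f: "map_poly complex_of_real f = smult (1 / 2) (p + p')"
    by (rule poly_eqI) (simp add: f_def p'_def coeff_map_poly complex_eq_iff)
  have g: "map_poly complex_of_real g = smult (- \<i> / 2) (p - p')"
    by (rule poly_eqI) (simp add: g_def p'_def coeff_map_poly complex_eq_iff)
  have f_op: "rop f A = poly_op p A"
  proof
    fix x
    have "rop f A x = (1 / 2) *\<^sub>C poly_op p A x + (1 / 2) *\<^sub>C poly_op p A x"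
      unfolding f poly_op_smult[OF lA] poly_op_add[OF lA] p'_op scaleC_add_right ..
    also have "\<dots> = poly_op p A x"
      by (simp add: scaleC_one flip: scaleC_add_left)
    finally show "rop f A x = poly_op p A x" .
  qed
  have g_op: "rop g A x = 0" for x
    unfolding g poly_op_smult[OF lA] poly_op_diff[OF lA] p'_op by simp
  show ?thesis
  proof (cases "f = 0")
    case False
    then show ?thesis using p(2) f_op by (intro exI[of _ f]) simp
  next
    case True
    have "g \<noteq> 0"
    proof
      assume "g = 0"
      have "coeff p n = 0" for n
        using arg_cong[OF True, of "\<lambda>h. coeff h n"] arg_cong[OF \<open>g = 0\<close>, of "\<lambda>h. coeff h n"]
        by (simp add: f_def g_def coeff_map_poly complex_eq_iff)
      then show False using p(1) by (simp add: poly_eq_iff)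
    qed
    moreover have "kpositive (rop g A)"
      by (simp add: kpositive_iff g_op)
    ultimately show ?thesis by blast
  qed
qed

text \<open>Dividing \<open>s\<close> by the linear factor leaves a nonzero constant, which settles
  the first power; multiplying two such identities raises the exponent by one.\<close>

lemma linear_power_bezout:
  fixes s :: "real poly"
  assumes "\<not> [:- l, 1:] dvd s"
  shows "\<exists>u v. u * [:- l, 1:] ^ k + v * s = 1"
proof -
  define L where "L = [:- l, 1:]"
  define c where "c = poly s l"
  have c: "c \<noteq> 0"
    using assms by (simp add: c_def poly_eq_0_iff_dvd)
  have "poly (s - [:c:]) l = 0" by (simp add: c_def)
  then obtain t where t: "s - [:c:] = L * t"
    unfolding poly_eq_0_iff_dvd L_def by (rule dvdE)
  define u where "u = smult (- 1 / c) t"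
  define v where "v = [:1 / c:]"
  have uv: "u * L + v * s = 1"
  proof -
    have "s = L * t + [:c:]" using t by (simp add: algebra_simps)
    then have "u * L + v * s = smult (- 1 / c) (L * t) + smult (1 / c) (L * t + [:c:])"
      by (simp add: u_def v_def mult.commute)
    also have "\<dots> = 1"
      using c by (simp add: smult_add_right one_pCons)
    finally show ?thesis .
  qed
  have "\<exists>u v. u * L ^ k + v * s = 1"
  proof (induction k)
    case 0
    show ?case by (intro exI[of _ 1] exI[of _ 0]) simp
  next
    case (Suc k)
    then obtain u' v' where 1: "u' * L ^ k + v' * s = 1" by blast
    have "1 = (u' * L ^ k + v' * s) * (u * L + v * s)"
      unfolding 1 uv by simp
    also have "\<dots> = (u' * u) * L ^ Suc k + (u' * L ^ k * v + v' * (u * L + v * s)) * s"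
      by (simp add: algebra_simps)
    finally show ?case by metis
  qed
  then show ?thesis unfolding L_def .
qed

context irreducible_commutant
begin

text \<open>Among the real annihilating polynomials take one of least degree. Minimality gives every
  nonconstant factor a nonzero kernel (\<open>factor\<close>), so its complex roots yield
  eigenvalues, and \<open>real\<close> leaves only real roots. A real root then splits the space by
  Bezout.\<close>

lemma nilpotent_of_annihilated:
  assumes q0: "q0 \<noteq> 0" "\<And>x. rop q0 A x = 0"
    and real: "\<And>m x. x \<noteq> 0 \<Longrightarrow> A x = m *\<^sub>C x \<Longrightarrow> m \<in> \<real>"
  shows "\<exists>l n. \<forall>x. rop ([:- l, 1:] ^ n) A x = 0"
proof -
  define P where "P q \<longleftrightarrow> q \<noteq> 0 \<and> (\<forall>x. rop q A x = 0)" for q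
  have "P q0" using q0 by (simp add: P_def)
  then obtain q where Pq: "P q" and min: "\<And>h. P h \<Longrightarrow> degree q \<le> degree h"
    using ex_has_least_nat[of P q0 degree] by blast
  have q: "q \<noteq> 0" "\<And>x. rop q A x = 0"
    using Pq by (auto simp: P_def)
  have factor: "\<exists>w. w \<noteq> 0 \<and> rop g A w = 0" if gh: "q = g * h" and dg: "degree g > 0" for g h
  proof -
    have "h \<noteq> 0" "g \<noteq> 0" using gh q(1) by auto
    then have "degree h < degree q" using dg by (simp add: gh degree_mult_eq)
    then have "\<not> P h" using min[of h] by auto
    then obtain x where "rop h A x \<noteq> 0" using \<open>h \<noteq> 0\<close> by (auto simp: P_def)
    moreover have "rop g A (rop h A x) = 0"
      using q(2)[of x] unfolding gh rop_mult[OF lA] .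
    ultimately show ?thesis by blast
  qed
  show ?thesis
  proof (cases "degree q = 0")
    case True
    then obtain c where c: "q = [:c:]" by (rule degree_eq_zeroE)
    \<comment> \<open>A nonzero constant annihilates only the zero space, where exponent 0
      suffices.\<close>
    have "rop ([:- 0, 1:] ^ 0) A x = 0" for x
    proof -
      have "of_real c *\<^sub>C x = 0" "c \<noteq> 0"
        using q(2)[of x] q(1) unfolding c rop_const[OF lA] by auto
      then have "(of_real (1 / c) * of_real c) *\<^sub>C x = 0"
        unfolding scaleC_scaleC[symmetric] by simp
      then have "x = 0"
        using \<open>c \<noteq> 0\<close> by (simp add: scaleC_one)
      then show ?thesis by (simp add: clinear_simps(3)[OF clinear_poly_op[OF lA]])
    qed
    then show ?thesis by blast
  next
    case False
    then have "degree (map_poly complex_of_real q) > 0"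
      by (simp add: degree_map_poly)
    then have "\<exists>z. poly (map_poly complex_of_real q) z = 0"
      by (rule alg_closed_imp_poly_has_root)
    then obtain z where z: "poly (map_poly complex_of_real q) z = 0" ..
    have "Im z = 0"
    proof (rule ccontr)
      assume Im: "Im z \<noteq> 0"
      define g where "g = [:(Re z)\<^sup>2 + (Im z)\<^sup>2, - 2 * Re z, 1:]"
      obtain h where h: "q = g * h"
        using real_poly_quadratic_factor[OF z Im] unfolding g_def by (rule dvdE)
      have "degree g > 0" by (simp add: g_def)
      from factor[OF h this] obtain w where w: "w \<noteq> 0" "rop g A w = 0" by blast
      have g: "map_poly complex_of_real g = [:- z, 1:] * [:- cnj z, 1:]"
        by (simp add: g_def map_poly_pCons complex_eq_iff power2_eq_square)
      \<comment> \<open>Either \<open>w'\<close> is zero and \<open>w\<close> has the eigenvalue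
        \<open>cnj z\<close>, or \<open>w'\<close> is an eigenvector for \<open>z\<close>; both
        contradict reality.\<close>
      define w' where "w' = A w - cnj z *\<^sub>C w"
      have Aw': "A w' - z *\<^sub>C w' = 0"
        using w(2) unfolding g poly_op_mult[OF lA] poly_op_linear_factor[OF lA] w'_def .
      show False
      proof (cases "w' = 0")
        case True
        then have "cnj z \<in> \<real>" by (intro real[OF w(1)]) (simp add: w'_def)
        then show False using Im by (simp add: complex_is_Real_iff)
      next
        case False
        then have "z \<in> \<real>" using Aw' by (intro real) simp_all
        then show False using Im by (simp add: complex_is_Real_iff)
      qed
    qed
    define l where "l = Re z"
    have "z = of_real l" using \<open>Im z = 0\<close> by (simp add: l_def complex_eq_iff)
    then have root: "poly q l = 0" using z by (simp add: poly_map_poly_of_real)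
    define k where "k = order l q"
    have k: "k \<noteq> 0" using root q(1) by (simp add: k_def order_root)
    define L where "L = [:- l, 1:]"
    obtain s where s: "q = L ^ k * s" "\<not> L dvd s"
      using order_decomp[OF q(1), of l] unfolding k_def L_def by blast
    obtain w where w: "w \<noteq> 0" "rop L A w = 0"
    proof -
      have "L dvd q" using root by (simp add: poly_eq_0_iff_dvd L_def)
      then obtain h where "q = L * h" by (rule dvdE)
      from factor[OF this] show thesis using that by (auto simp: L_def)
    qed
    obtain u v where uv: "u * L ^ k + v * s = 1"
      using linear_power_bezout[OF s(2)[unfolded L_def]] unfolding L_def by blast
    \<comment> \<open>\<open>Q\<close> is the Riesz projection onto the kernel of
      \<open>L^k(A)\<close>, and \<open>E\<close> is the complementary projection. The dichotomy is
      applied to the kernel of \<open>Q\<close>, which is the range of the self-adjoint projection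
      \<open>E\<close>.\<close>
    define E where "E = rop (u * L ^ k) A"
    define Q where "Q = rop (v * s) A"
    have EQ: "E x + Q x = x" for x
      unfolding E_def Q_def rop_add[OF lA, symmetric] uv by (rule rop_one[OF lA])
    have bE: "bounded_operator E" and bQ: "bounded_operator Q"
      unfolding E_def Q_def by (rule bounded_operator_poly_op[OF bA])+
    note E_simps = clinear_simps[OF bounded_operator_clinear[OF bE]]
    have E_Q: "E (Q x) = 0" for x
    proof -
      have eq: "u * L ^ k * (v * s) = u * v * q" unfolding s(1) by simp
      show ?thesis
        unfolding E_def Q_def rop_mult[OF lA, symmetric] eq unfolding rop_mult[OF lA] q(2)
        by (simp add: clinear_simps(3)[OF clinear_poly_op[OF lA]])
    qed
    have EE: "E (E x) = E x" for x
      using arg_cong[OF EQ[of x], of E] by (simp add: E_simps E_Q)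
    have ker_Q: "Q x = 0 \<longleftrightarrow> E x = x" for x
      using EQ[of x] by (metis add.right_neutral add_left_cancel)
    have sE: "kselfadjoint E"
      unfolding kselfadjoint_def is_kadjoint_def E_def
      by (intro allI rop_adjoint[OF lA sA])
    have "regular_subspace {x. Q x = 0}"
      unfolding ker_Q by (rule regular_projection_range[OF bE sE EE])
    then have "(\<forall>x. Q x = 0) \<or> (\<forall>x. Q x = 0 \<longrightarrow> x = 0)"
      unfolding Q_def by (intro kernel_dichotomy G_rop)
    then have "\<forall>x. rop (L ^ k) A x = 0"
    proof
      assume "\<forall>x. Q x = 0"
      \<comment> \<open>Impossible: \<open>E\<close> contains a factor \<open>L(A)\<close>, which
        kills the eigenvector \<open>w\<close>.\<close>
      then have "w = E w" using EQ[of w] by simp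
      also have "E w = rop (u * L ^ (k - 1)) A (rop L A w)"
      proof -
        have "u * L ^ k = u * L ^ (k - 1) * L"
          using k by (cases k) simp_all
        then show ?thesis unfolding E_def by (simp only: rop_mult[OF lA])
      qed
      also have "\<dots> = 0"
        unfolding w(2) by (rule clinear_simps(3)[OF clinear_poly_op[OF lA]])
      finally show ?thesis using w(1) by simp
    next
      assume inj: "\<forall>x. Q x = 0 \<longrightarrow> x = 0"
      have "E x = 0" for x
        using inj EE[of x] ker_Q[of "E x"] by blast
      then have Qx: "Q x = x" for x using EQ[of x] by simp
      have "rop (L ^ k) A x = 0" for x
      proof -
        have eq: "L ^ k * (v * s) = v * q" unfolding s(1) by simp
        have "rop (L ^ k) A x = rop (L ^ k) A (Q x)" unfolding Qx ..
        also have "\<dots> = rop v A (rop q A x)"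
          unfolding Q_def rop_mult[OF lA, symmetric] eq ..
        also have "\<dots> = 0"
          unfolding q(2) by (rule clinear_simps(3)[OF clinear_poly_op[OF lA]])
        finally show ?thesis .
      qed
      then show ?thesis ..
    qed
    then show ?thesis unfolding L_def by blast
  qed
qed

lemma rop_linear_power: "rop ([:- l, 1:] ^ n) A x = ((\<lambda>x. A x - of_real l *\<^sub>C x) ^^ n) x"
proof (induction n arbitrary: x)
  case 0
  show ?case unfolding power_0 rop_one[OF lA] by simp
next
  case (Suc n)
  have "rop [:- l, 1:] A y = A y - of_real l *\<^sub>C y" for y
    unfolding rop_linear[OF lA] by (simp add: scaleC_one)
  then show ?case
    unfolding power_Suc2 rop_mult[OF lA] Suc funpow_Suc_right by simp
qed

lemma nilpotent_plus_scalar: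
  assumes p: "p \<noteq> 0" "kpositive (rop p A)"
    and real: "\<And>m x. x \<noteq> 0 \<Longrightarrow> A x = m *\<^sub>C x \<Longrightarrow> m \<in> \<real>"
  shows "\<exists>l::real. \<exists>n. \<forall>x. ((\<lambda>x. A x - of_real l *\<^sub>C x) ^^ n) x = 0"
proof (cases "definite 1 \<or> definite (- 1)")
  case True
  then obtain l :: real where "\<forall>x. A x = of_real l *\<^sub>C x"
    using scalar_of_definite by blast
  then show ?thesis by (intro exI[of _ l] exI[of _ 1]) simp
next
  case False
  then have "rop (p * p) A x = 0" for x
    unfolding rop_mult[OF lA] using rop_square_zero[OF p(2)] by blast
  moreover have "p * p \<noteq> 0" using p(1) by simp
  ultimately have "\<exists>l n. \<forall>x. rop ([:- l, 1:] ^ n) A x = 0"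
    by (intro nilpotent_of_annihilated[of "p * p"] real)
  then show ?thesis unfolding rop_linear_power .
qed

text \<open>Symmetry gives \<open>(m - cnj m) [y, y] = 0\<close> on the eigenspace of
  \<open>m\<close>. For non-real \<open>m\<close> this eigenspace would be a nonzero neutral
  invariant subspace.\<close>

lemma eigenvalue_real:
  assumes "nondegenerate_representation G" "x \<noteq> 0" "A x = m *\<^sub>C x"
  shows "m \<in> \<real>"
proof (rule ccontr)
  assume m: "m \<notin> \<real>"
  define S where "S = {y. A y = m *\<^sub>C y}"
  have sub: "module.subspace scaleC S"
    unfolding complex_vector.subspace_def S_def
    by (simp add: A_simps scaleC_add_right scaleC_scaleC mult.commute)
  have "neutral_subspace S"
    unfolding neutral_subspace_def
  proof (intro conjI sub ballI)
    fix y assume "y \<in> S"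
    then have y: "A y = m *\<^sub>C y" by (simp add: S_def)
    have "kform (A y) y = kform y (A y)"
      using sA by (simp add: kselfadjoint_def is_kadjoint_def)
    then have "(m - cnj m) * kform y y = 0"
      unfolding y by (simp add: kform_simps left_diff_distrib)
    moreover have "m - cnj m \<noteq> 0"
      using m by (simp add: Reals_cnj_iff)
    ultimately show "kform y y = 0" by simp
  qed
  moreover have "invariant_subspace G S"
    unfolding invariant_subspace_def
  proof (intro conjI sub ballI subsetI)
    fix T y assume T: "T \<in> G" and "y \<in> T ` S"
    then obtain v where v: "A v = m *\<^sub>C v" "y = T v" by (auto simp: S_def)
    have "A (T v) = T (m *\<^sub>C v)" using GA[OF T, of v] v(1) by simp
    then show "y \<in> S"
      by (simp add: S_def v(2) clinear_simps[OF bounded_operator_clinear[OF bG[OF T]]])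
  qed
  ultimately have "S = {0}"
    using assms(1) unfolding nondegenerate_representation_def by blast
  then show False using assms(2,3) unfolding S_def by blast
qed

text \<open>If \<open>N^{n+2} = 0\<close> then \<open>[N^{n+1} x, N^{n+1} x] = [N^{2n+2} x, x] = 0\<close>, so the range of
  \<open>N^{n+1}\<close> is neutral.\<close>

lemma nilpotent_part_zero:
  fixes l :: real
  defines "N \<equiv> \<lambda>x. A x - of_real l *\<^sub>C x"
  assumes nd: "nondegenerate_representation G" and "\<And>x. (N ^^ n) x = 0"
  shows "N x = 0"
  using assms(3)
proof (induction n arbitrary: x)
  case 0
  have "y = 0" for y :: 'a using 0[of y] by simp
  then show ?case .
next
  case (Suc n)
  note Nn = Suc.prems
  show ?case
  \<comment> \<open>The range argument needs \<open>2 * n \<ge> n + 1\<close>, so exponent 1 is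
    handled directly.\<close>
  proof (cases n)
    case 0
    then show ?thesis using Nn[of x] by simp
  next
    case (Suc k)
    have bN: "bounded_operator N"
      unfolding N_def
      by (rule bounded_operator_diff[OF bA bounded_operator_scale[OF bounded_operator_ident]])
    have N_sym: "kform (N x) y = kform x (N y)" for x y
      using sA by (simp add: kselfadjoint_def is_kadjoint_def N_def kform_simps)
    have Npow: "rop ([:- l, 1:] ^ j) A = N ^^ j" for j
      by (rule ext) (simp only: rop_linear_power N_def)
    have lin: "clinear (N ^^ j)" for j
      unfolding Npow[symmetric] by (rule clinear_poly_op[OF lA])
    have sym: "kform ((N ^^ j) x) y = kform x ((N ^^ j) y)" for j x y
      unfolding Npow[symmetric] by (rule rop_adjoint[OF lA sA])
    define S where "S = range (N ^^ n)"
    have sub: "module.subspace scaleC S"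
      unfolding complex_vector.subspace_def S_def
    proof (intro conjI ballI allI)
      show "0 \<in> range (N ^^ n)"
        using rangeI[of "N ^^ n" 0] unfolding clinear_simps(3)[OF lin] .
      fix x y assume "x \<in> range (N ^^ n)" "y \<in> range (N ^^ n)"
      then obtain u v where "x = (N ^^ n) u" "y = (N ^^ n) v" by (elim rangeE)
      then have "x + y = (N ^^ n) (u + v)" by (simp only: clinear_simps(1)[OF lin])
      then show "x + y \<in> range (N ^^ n)" by (rule range_eqI)
    next
      fix c x assume "x \<in> range (N ^^ n)"
      then obtain u where "x = (N ^^ n) u" by (elim rangeE)
      then have "c *\<^sub>C x = (N ^^ n) (c *\<^sub>C u)" by (simp only: clinear_simps(2)[OF lin])
      then show "c *\<^sub>C x \<in> range (N ^^ n)" by (rule range_eqI)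
    qed
    have "neutral_subspace S"
      unfolding neutral_subspace_def
    proof (intro conjI sub ballI)
      fix y assume "y \<in> S"
      then obtain x where x: "y = (N ^^ n) x" unfolding S_def by (elim rangeE)
      have "kform y y = kform x ((N ^^ n) ((N ^^ n) x))"
        unfolding x by (rule sym)
      also have "(N ^^ n) ((N ^^ n) x) = (N ^^ k) ((N ^^ Suc n) x)"
      proof -
        \<comment> \<open>Symmetry of the powers puts \<open>2 * n\<close> copies of
          \<open>N\<close> on one side of the form, and \<open>Suc n\<close> of them already give
          zero.\<close>
        have "n + n = k + Suc n" using Suc by simp
        then have "N ^^ (n + n) = N ^^ (k + Suc n)" by (simp only:)
        then show ?thesis unfolding funpow_add by (simp only: fun_eq_iff comp_apply)
      qed
      also have "\<dots> = 0"
        unfolding Nn by (rule clinear_simps(3)[OF lin])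
      finally show "kform y y = 0" by simp
    qed
    moreover have "invariant_subspace G S"
      unfolding invariant_subspace_def
    proof (intro conjI sub ballI subsetI)
      fix T y assume T: "T \<in> G" and "y \<in> T ` S"
      then obtain x where x: "y = T ((N ^^ n) x)" unfolding S_def by blast
      have "T ((N ^^ n) x) = (N ^^ n) (T x)"
        unfolding Npow[symmetric] by (rule G_rop[OF T])
      then show "y \<in> S" unfolding x S_def by (rule range_eqI)
    qed
    ultimately have "S = {0}"
      using nd unfolding nondegenerate_representation_def by blast
    then have "(N ^^ n) x = 0" for x
      unfolding S_def by blast
    then show ?thesis by (rule Suc.IH)
  qed
qed

end

theorem lemma2p12:
  fixes G :: "('a::krein_space \<Rightarrow> 'a) set" and A :: "'a \<Rightarrow> 'a"
  assumes "subgroup G unitary_group"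
    and "regularly_irreducible G"
    and "bounded_operator A"
    and "definitizable A"
    and "\<And>T. T \<in> G \<Longrightarrow> T \<circ> A = A \<circ> T"
  shows "((\<forall>\<mu> x. x \<noteq> 0 \<and> A x = \<mu> *\<^sub>C x \<longrightarrow> \<mu> \<in> \<real>) \<longrightarrow>
            (\<exists>N c. nilpotent_operator N \<and> A = (\<lambda>x. N x + c *\<^sub>C x))) \<and>
         (nondegenerate_representation G \<longrightarrow> (\<exists>c. A = (\<lambda>x. c *\<^sub>C x)))"
proof -
  interpret irreducible_commutant G A
  proof
    show "bounded_operator T" if "T \<in> G" for T
      using subgroup.subset[OF assms(1)] that by (auto simp: unitary_group_def kunitary_def)
    show "T (A x) = A (T x)" if "T \<in> G" for T x
      using fun_cong[OF assms(5)[OF that], of x] by simp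
    show "kselfadjoint A"
      using assms(4) unfolding definitizable_def by blast
  qed (rule assms(2,3))+
  obtain p where p: "p \<noteq> 0" "kpositive (rop p A)"
    using real_definitizing_polynomial[OF assms(3,4)] by blast
  show ?thesis
  proof (intro conjI impI)
    assume real: "\<forall>\<mu> x. x \<noteq> 0 \<and> A x = \<mu> *\<^sub>C x \<longrightarrow> \<mu> \<in> \<real>"
    obtain l :: real and n where n: "\<forall>x. ((\<lambda>x. A x - of_real l *\<^sub>C x) ^^ n) x = 0"
      using nilpotent_plus_scalar[OF p] real by blast
    have "nilpotent_operator (\<lambda>x. A x - of_real l *\<^sub>C x)"
      unfolding nilpotent_operator_def
      using n bounded_operator_diff[OF bA bounded_operator_scale[OF bounded_operator_ident]] by blast
    moreover have "A = (\<lambda>x. A x - of_real l *\<^sub>C x + of_real l *\<^sub>C x)"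
      by simp
    ultimately show "\<exists>N c. nilpotent_operator N \<and> A = (\<lambda>x. N x + c *\<^sub>C x)" by blast
  next
    assume nd: "nondegenerate_representation G"
    have "\<exists>l::real. \<exists>n. \<forall>x. ((\<lambda>x. A x - of_real l *\<^sub>C x) ^^ n) x = 0"
      \<comment> \<open>Nondegeneracy supplies the reality of eigenvalues that the first claim
        assumes.\<close>
      by (rule nilpotent_plus_scalar[OF p]) (rule eigenvalue_real[OF nd])
    then obtain l :: real and n where n: "\<forall>x. ((\<lambda>x. A x - of_real l *\<^sub>C x) ^^ n) x = 0"
      by (elim exE)
    have "A x - of_real l *\<^sub>C x = 0" for x
      by (rule nilpotent_part_zero[OF nd]) (use n in blast)
    then have "A = (\<lambda>x. of_real l *\<^sub>C x)" by (intro ext) simp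
    then show "\<exists>c. A = (\<lambda>x. c *\<^sub>C x)" ..
  qed
qed

end
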